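(* Let $G=(V,E)$ be a network graph and $M\ge 1$ an integer, and let $G^c=[L(G)]^M$ be its conflict graph under the $M$-hop interference model. Constructing $G^c$ from $G$ and then running the eLehot algorithm on $G^c$ (to decide whether $G^c$ is a line multigraph and, if so, output a root multigraph $G'$ with $L(G')=G^c$) takes time $O(|E|^3)$.
   Context: $L(G)$ denotes the line graph of $G$ (vertices are edges of $G$, adjacent iff they share an end vertex). For a graph $X$ and $t\in\mathbb{N}$, the power $X^t$ has the same vertices as $X$, two vertices being adjacent iff their distance in $X$ is at most $t$. Thus $G^c$ has vertex set $E$, and its number of edges $|L|$ is at most $|E|(|E|-1)/2$. Two distinct vertices of a simple graph are true twins if they are adjacent and have equal closed neighbourhoods. The eLehot algorithm on input $G^c$: Step 1: contract every edge of $G^c$ whose end vertices are true twins, obtaining the simple graph $H$ whose vertices are the true-twin classes (two classes adjacent iff their vertices are adjacent), each labelled by the class size. Step 2: run Lehot's algorithm on $H$, which runs in time linear in the number of vertices plus edges of $H$ and outputs a simple graph $H'$ with $L(H')=H$ if one exists. Step 3: if $H'$ is output, replace each edge of $H'$ by as many parallel edges as the label of the corresponding vertex of $H$, giving the output $G'$. *)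

theory Defs
  imports Complex_Main "HOL-Library.Landau_Symbols" "HOL-Library.Extended_Nat"
begin

section \<open>Graphs and multigraphs\<close>

text \<open>Undirected graphs; an edge is the set of its two end vertices.\<close>

record 'v graph =
  verts :: "'v set"
  edges :: "'v set set"

definition simple_graph :: "'v graph \<Rightarrow> bool" where
  "simple_graph X \<longleftrightarrow> finite (verts X) \<and> (\<forall>e\<in>edges X. e \<subseteq> verts X \<and> card e = 2)"

definition graph_iso :: "('u \<Rightarrow> 'v) \<Rightarrow> 'u graph \<Rightarrow> 'v graph \<Rightarrow> bool" where
  "graph_iso f X Y \<longleftrightarrow> bij_betw f (verts X) (verts Y) \<and>
     (\<forall>u\<in>verts X. \<forall>v\<in>verts X. {u, v} \<in> edges X \<longleftrightarrow> {f u, f v} \<in> edges Y)"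

definition isomorphic :: "'u graph \<Rightarrow> 'v graph \<Rightarrow> bool" where
  "isomorphic X Y \<longleftrightarrow> (\<exists>f. graph_iso f X Y)"

definition line_graph :: "'v graph \<Rightarrow> 'v set graph" where
  "line_graph X = \<lparr>verts = edges X,
     edges = {{e, f} | e f. e \<in> edges X \<and> f \<in> edges X \<and> e \<noteq> f \<and> e \<inter> f \<noteq> {}}\<rparr>"

definition walk :: "'v graph \<Rightarrow> 'v list \<Rightarrow> bool" where
  "walk X p \<longleftrightarrow> p \<noteq> [] \<and> set p \<subseteq> verts X \<and>
     (\<forall>i. Suc i < length p \<longrightarrow> {p ! i, p ! Suc i} \<in> edges X)"

text \<open>The infimum of the empty set is \<open>\<infinity>\<close>, the distance between different components.\<close>

definition distance :: "'v graph \<Rightarrow> 'v \<Rightarrow> 'v \<Rightarrow> enat" where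
  "distance X u v = (INF p\<in>{p. walk X p \<and> hd p = u \<and> last p = v}. enat (length p - 1))"

definition graph_power :: "'v graph \<Rightarrow> nat \<Rightarrow> 'v graph" where
  "graph_power X t = \<lparr>verts = verts X,
     edges = {{u, v} | u v. u \<in> verts X \<and> v \<in> verts X \<and> u \<noteq> v \<and> distance X u v \<le> enat t}\<rparr>"

definition conflict_graph :: "'v graph \<Rightarrow> nat \<Rightarrow> 'v set graph" where
  "conflict_graph X M = graph_power (line_graph X) M"

definition closed_nbhd :: "'v graph \<Rightarrow> 'v \<Rightarrow> 'v set" where
  "closed_nbhd X u = insert u {v \<in> verts X. {u, v} \<in> edges X}"

definition true_twins :: "'v graph \<Rightarrow> 'v \<Rightarrow> 'v \<Rightarrow> bool" where
  "true_twins X u v \<longleftrightarrow> u \<noteq> v \<and> {u, v} \<in> edges X \<and> closed_nbhd X u = closed_nbhd X v"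

definition twin_class :: "'v graph \<Rightarrow> 'v \<Rightarrow> 'v set" where
  "twin_class X u = {v \<in> verts X. v = u \<or> true_twins X u v}"

definition contraction :: "'v graph \<Rightarrow> 'v set graph" where
  "contraction X = \<lparr>verts = twin_class X ` verts X,
     edges = {{twin_class X u, twin_class X v} | u v.
       u \<in> verts X \<and> v \<in> verts X \<and> {u, v} \<in> edges X \<and> twin_class X u \<noteq> twin_class X v}\<rparr>"

text \<open>Multigraphs have named edges, so that parallel edges are distinct; loops are excluded.\<close>

record ('v, 'e) multigraph =
  mverts :: "'v set"
  medges :: "'e set"
  ends :: "'e \<Rightarrow> 'v set"

definition multigraph :: "('v, 'e) multigraph \<Rightarrow> bool" where
  "multigraph G \<longleftrightarrow> finite (mverts G) \<and> finite (medges G) \<and>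
     (\<forall>e\<in>medges G. ends G e \<subseteq> mverts G \<and> card (ends G e) = 2)"

definition line_graph_of_multigraph :: "('v, 'e) multigraph \<Rightarrow> 'e graph" where
  "line_graph_of_multigraph G = \<lparr>verts = medges G,
     edges = {{e, f} | e f. e \<in> medges G \<and> f \<in> medges G \<and> e \<noteq> f \<and> ends G e \<inter> ends G f \<noteq> {}}\<rparr>"

text \<open>Natural numbers suffice as names in the next two definitions because the graphs considered
  are finite.\<close>

definition is_line_graph :: "'v graph \<Rightarrow> bool" where
  "is_line_graph X \<longleftrightarrow> (\<exists>Y :: nat graph. simple_graph Y \<and> isomorphic (line_graph Y) X)"

definition is_line_multigraph :: "'v graph \<Rightarrow> bool" where
  "is_line_multigraph X \<longleftrightarrow>
     (\<exists>Y :: (nat, nat) multigraph. multigraph Y \<and> isomorphic (line_graph_of_multigraph Y) X)"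


section \<open>The machine model\<close>

text \<open>A while language over arrays of natural numbers, with unit-cost array access, addition,
  truncated subtraction and comparison (a unit-cost random access machine without
  multiplication). A scalar variable is an array of which only cell 0 is used.\<close>

type_synonym vname = string
type_synonym state = "vname \<Rightarrow> nat \<Rightarrow> nat"

datatype aexp = N nat | Cell vname aexp | Plus aexp aexp | Minus aexp aexp

datatype bexp = Less aexp aexp | Eq aexp aexp | Not bexp | And bexp bexp

datatype com =
    SKIP
  | Assign vname aexp aexp  \<comment> \<open>\<open>Assign x i a\<close> means \<open>x[i] := a\<close>\<close>
  | Seq com com  (infixr ";;" 60)
  | If bexp com com
  | While bexp com

fun aval :: "aexp \<Rightarrow> state \<Rightarrow> nat" where
  "aval (N n) s = n"
| "aval (Cell x a) s = s x (aval a s)"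
| "aval (Plus a b) s = aval a s + aval b s"
| "aval (Minus a b) s = aval a s - aval b s"

fun bval :: "bexp \<Rightarrow> state \<Rightarrow> bool" where
  "bval (Less a b) s \<longleftrightarrow> aval a s < aval b s"
| "bval (Eq a b) s \<longleftrightarrow> aval a s = aval b s"
| "bval (Not b) s \<longleftrightarrow> \<not> bval b s"
| "bval (And b c) s \<longleftrightarrow> bval b s \<and> bval c s"

fun acost :: "aexp \<Rightarrow> nat" where
  "acost (N n) = 1"
| "acost (Cell x a) = 1 + acost a"
| "acost (Plus a b) = 1 + acost a + acost b"
| "acost (Minus a b) = 1 + acost a + acost b"

fun bcost :: "bexp \<Rightarrow> nat" where
  "bcost (Less a b) = 1 + acost a + acost b"
| "bcost (Eq a b) = 1 + acost a + acost b"
| "bcost (Not b) = 1 + bcost b"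
| "bcost (And b c) = 1 + bcost b + bcost c"

text \<open>\<open>exec c s t s'\<close>: started in \<open>s\<close>, the program \<open>c\<close> halts in \<open>s'\<close> after exactly \<open>t\<close> steps.\<close>

inductive exec :: "com \<Rightarrow> state \<Rightarrow> nat \<Rightarrow> state \<Rightarrow> bool" where
  Skip: "exec SKIP s 1 s"
| Assign: "exec (Assign x i a) s (1 + acost i + acost a) (s(x := (s x)(aval i s := aval a s)))"
| Seq: "exec c1 s t1 s1 \<Longrightarrow> exec c2 s1 t2 s2 \<Longrightarrow> exec (c1 ;; c2) s (t1 + t2) s2"
| IfTrue: "bval b s \<Longrightarrow> exec c1 s t s' \<Longrightarrow> exec (If b c1 c2) s (1 + bcost b + t) s'"
| IfFalse: "\<not> bval b s \<Longrightarrow> exec c2 s t s' \<Longrightarrow> exec (If b c1 c2) s (1 + bcost b + t) s'"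
| WhileFalse: "\<not> bval b s \<Longrightarrow> exec (While b c) s (1 + bcost b) s"
| WhileTrue: "bval b s \<Longrightarrow> exec c s t1 s1 \<Longrightarrow> exec (While b c) s1 t2 s2 \<Longrightarrow>
    exec (While b c) s (1 + bcost b + t1 + t2) s2"

text \<open>Halting state and running time are unique, so an existential statement about \<open>exec\<close> is a
  statement about \<^emph>\<open>the\<close> run of the program.\<close>

lemma exec_deterministic:
  "exec c s t s' \<Longrightarrow> exec c s u s'' \<Longrightarrow> t = u \<and> s' = s''"
proof (induction arbitrary: u s'' rule: exec.induct)
  case (Seq c1 s t1 s1 c2 t2 s2)
  from Seq.prems show ?case by cases (use Seq.IH in blast)
next
  case (WhileTrue b s c t1 s1 t2 s2)
  from WhileTrue.prems show ?case by cases (use WhileTrue.IH WhileTrue.hyps in blast)+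
qed (erule exec.cases; force)+


section \<open>Graphs in memory\<close>

text \<open>A graph occupies one array: number of vertices, number of edges, then the two ends of each
  edge. Its vertices are named \<open>0, 1, \<dots>\<close> and its edges are numbered in the order of storage.\<close>

definition edge_at :: "(nat \<Rightarrow> nat) \<Rightarrow> nat \<Rightarrow> nat set" where
  "edge_at a j = {a (2 + 2 * j), a (3 + 2 * j)}"

definition multigraph_of :: "(nat \<Rightarrow> nat) \<Rightarrow> (nat, nat) multigraph" where
  "multigraph_of a = \<lparr>mverts = {..<a 0}, medges = {..<a 1}, ends = edge_at a\<rparr>"

definition graph_of :: "(nat \<Rightarrow> nat) \<Rightarrow> nat graph" where
  "graph_of a = \<lparr>verts = {..<a 0}, edges = edge_at a ` {..<a 1}\<rparr>"

text \<open>Injectivity: each edge of a stored simple graph is listed only once.\<close>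

definition holds_simple_graph :: "(nat \<Rightarrow> nat) \<Rightarrow> bool" where
  "holds_simple_graph a \<longleftrightarrow> simple_graph (graph_of a) \<and> inj_on (edge_at a) {..<a 1}"

definition stores :: "(nat \<Rightarrow> nat) \<Rightarrow> 'v graph \<Rightarrow> bool" where
  "stores a X \<longleftrightarrow> holds_simple_graph a \<and> isomorphic (graph_of a) X"


section \<open>The eLehot algorithm\<close>

text \<open>Arrays used for communication: \<open>''Gc''\<close> is the input graph, \<open>''H''\<close> and \<open>''label''\<close> the
  result of Step 1, \<open>''found''\<close> and \<open>''root''\<close> the result of Step 2, \<open>''found''\<close> and \<open>''out''\<close> the
  final result. All programs must work whatever the other arrays contain initially.\<close>

definition contracts_true_twins :: "com \<Rightarrow> bool" where
  "contracts_true_twins c \<longleftrightarrow> (\<forall>s. holds_simple_graph (s ''Gc'') \<longrightarrow>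
     (\<exists>t s' f. exec c s t s' \<and> holds_simple_graph (s' ''H'') \<and>
        graph_iso f (graph_of (s' ''H'')) (contraction (graph_of (s ''Gc''))) \<and>
        (\<forall>k<s' ''H'' 0. s' ''label'' k = card (f k))))"

text \<open>Lehot's algorithm: decides in linear time whether \<open>''H''\<close> is a line graph and if so produces a
  root whose edge number \<open>k\<close> corresponds to the vertex \<open>k\<close> of \<open>''H''\<close>. As a subroutine it must not
  overwrite its caller's array \<open>''label''\<close>.\<close>

definition lehot_algorithm :: "com \<Rightarrow> bool" where
  "lehot_algorithm c \<longleftrightarrow> (\<exists>T :: nat \<Rightarrow> real. T \<in> O(\<lambda>n. real n) \<and>
     (\<forall>s. holds_simple_graph (s ''H'') \<longrightarrow>
       (\<exists>t s'. exec c s t s' \<and>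
          real t \<le> T (card (verts (graph_of (s ''H''))) + card (edges (graph_of (s ''H'')))) \<and>
          s' ''label'' = s ''label'' \<and>
          s' ''found'' 0 = (if is_line_graph (graph_of (s ''H'')) then 1 else 0) \<and>
          (s' ''found'' 0 = 1 \<longrightarrow> holds_simple_graph (s' ''root'') \<and>
             graph_iso (edge_at (s' ''root'')) (graph_of (s ''H''))
               (line_graph (graph_of (s' ''root'')))))))"

text \<open>Step 3: edge \<open>k\<close> of \<open>''root''\<close> becomes \<open>label[k]\<close> parallel edges of \<open>''out''\<close>; the edge \<open>j\<close> of
  \<open>''out''\<close> is copy number \<open>snd (\<beta> j)\<close> of the edge \<open>fst (\<beta> j)\<close> of \<open>''root''\<close>.\<close>

definition multiplies_edges :: "com \<Rightarrow> bool" where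
  "multiplies_edges c \<longleftrightarrow> (\<forall>s. (s ''found'' 0 = 1 \<longrightarrow> holds_simple_graph (s ''root'')) \<longrightarrow>
     (\<exists>t s'. exec c s t s' \<and> s' ''found'' 0 = s ''found'' 0 \<and>
        (s ''found'' 0 = 1 \<longrightarrow> s' ''out'' 0 = s ''root'' 0 \<and>
           (\<exists>\<beta>. bij_betw \<beta> {..<s' ''out'' 1} (SIGMA k:{..<s ''root'' 1}. {..<s ''label'' k}) \<and>
              (\<forall>j<s' ''out'' 1. edge_at (s' ''out'') j = edge_at (s ''root'') (fst (\<beta> j)))))))"

definition elehot_algorithm :: "com \<Rightarrow> com \<Rightarrow> bool" where
  "elehot_algorithm lehot c \<longleftrightarrow>
     (\<exists>step1 step3. c = step1 ;; lehot ;; step3 \<and> contracts_true_twins step1 \<and> multiplies_edges step3)"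

end

theory Submission
  imports Defs
begin

text \<open>Distances in the line graph are computed by the Floyd--Warshall algorithm, and true twins are
  recognised as equal rows of the adjacency matrix with ones on the diagonal; both take cubic time in
  the number \<open>|E|\<close> of vertices of the conflict graph, and the contracted graph handed to Lehot's
  algorithm has size at most quadratic in \<open>|E|\<close>. Contracting is correct because parallel edges of a
  multigraph are true twins of its line graph: one vertex from each twin class gives the line graph
  of a simple graph, and conversely multiplying the edges of a simple root restores the classes.\<close>


text \<open>The bound must depend neither on M nor on the number of vertices of G. So no program
  loops over the vertices of G or counts up to M: the line graph is handled on the positions of the
  stored edges, and M enters only through the initial entries M + 1, which stand for infinity, and
  through one final comparison. Computing all distances at once, rather than extending walks M
  times, is what makes this possible. Finding the twin classes is cubic because each of the |E|
  vertices is compared with at most |E| representatives, in rows of |E| entries. Multiplying edges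
  costs at most the number of root edges times the largest label, and both are at most |E|. Lehot's
  algorithm is an arbitrary program with a time function that is controlled only asymptotically and
  need not be monotone. It is first replaced by c (n + 1), valid for all n; only then can the size
  of the contracted graph be estimated. Since |E| may be 0, all bounds are powers of |E| +
  1.\<close>

section \<open>Running times of bounded loops\<close>

text \<open>The cost of a pass that runs every loop body once and, at a conditional, pays for both
  branches. Repetition is left to the power of \<open>B\<close> in \<open>runs\<close>, so this
  number depends on the program text alone.\<close>

fun coef :: "com \<Rightarrow> nat" where
  "coef SKIP = 1"
| "coef (Assign x i a) = 1 + acost i + acost a"
| "coef (Seq c1 c2) = coef c1 + coef c2"
| "coef (If b c1 c2) = 1 + bcost b + coef c1 + coef c2"
| "coef (While b c) = 1 + bcost b + coef c"

fun writes :: "com \<Rightarrow> vname set" where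
  "writes SKIP = {}"
| "writes (Assign x i a) = {x}"
| "writes (Seq c1 c2) = writes c1 \<union> writes c2"
| "writes (If b c1 c2) = writes c1 \<union> writes c2"
| "writes (While b c) = writes c"

text \<open>The frame condition. It is what remains known, in an arbitrary pass of a loop, about the
  state in which the loop was started.\<close>

definition agree :: "vname set \<Rightarrow> state \<Rightarrow> state \<Rightarrow> bool" where
  "agree W s s' \<longleftrightarrow> (\<forall>y. y \<notin> W \<longrightarrow> s' y = s y)"

lemma exec_agree: "exec c s t s' \<Longrightarrow> agree (writes c) s s'"
  by (induction rule: exec.induct) (auto simp: agree_def)

lemma agree_trans: "agree W s s' \<Longrightarrow> agree W' s' s'' \<Longrightarrow> W \<union> W' \<subseteq> W'' \<Longrightarrow> agree W'' s s''"
  unfolding agree_def by (metis UnCI subsetD)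

lemma le_mult_power: "0 < B \<Longrightarrow> k \<le> k * B ^ d" for B k d :: nat
  using mult_le_mono2[of 1 "B ^ d" k] by (simp add: Suc_le_eq)

text \<open>The base \<open>B\<close> bounds the lengths of the loops and \<open>d\<close> the depth of their nesting, so that
  the constant can be read off the program text.\<close>

definition runs :: "nat \<Rightarrow> nat \<Rightarrow> com \<Rightarrow> state \<Rightarrow> (state \<Rightarrow> bool) \<Rightarrow> bool" where
  "runs B d c s Q \<longleftrightarrow> (\<exists>t s'. exec c s t s' \<and> t \<le> coef c * B ^ d \<and> Q s')"

text \<open>The frame condition comes with every run, since \<open>writes\<close> bounds
  syntactically what can change. Postconditions therefore mention only the arrays being
  computed.\<close>

lemma runs_conseq:
  assumes "runs B d c s Q" and "\<And>s'. Q s' \<Longrightarrow> agree (writes c) s s' \<Longrightarrow> Q' s'"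
  shows "runs B d c s Q'"
  using assms exec_agree unfolding runs_def by metis

lemma runs_raise:
  assumes "runs B d c s Q" and "d \<le> d'" and "0 < B"
  shows "runs B d' c s Q"
proof -
  have "coef c * B ^ d \<le> coef c * B ^ d'"
    using assms by (simp add: power_increasing)
  then show ?thesis
    using assms(1) unfolding runs_def by (meson le_trans)
qed

lemma runs_Seq:
  assumes "runs B d c1 s R"
    and "\<And>s'. R s' \<Longrightarrow> agree (writes c1) s s' \<Longrightarrow> runs B d c2 s' Q"
  shows "runs B d (c1 ;; c2) s Q"
proof -
  obtain t1 s1 where 1: "exec c1 s t1 s1" "t1 \<le> coef c1 * B ^ d" "R s1"
    using assms(1) unfolding runs_def by blast
  obtain t2 s2 where 2: "exec c2 s1 t2 s2" "t2 \<le> coef c2 * B ^ d" "Q s2"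
    using assms(2)[OF 1(3) exec_agree[OF 1(1)]] unfolding runs_def by blast
  have "t1 + t2 \<le> coef (c1 ;; c2) * B ^ d"
    using 1(2) 2(2) by (simp add: add_mult_distrib)
  with exec.Seq[OF 1(1) 2(1)] 2(3) show ?thesis
    unfolding runs_def by blast
qed

lemma runs_If:
  assumes "0 < B" and "bval b s \<Longrightarrow> runs B d c1 s Q" and "\<not> bval b s \<Longrightarrow> runs B d c2 s Q"
  shows "runs B d (If b c1 c2) s Q"
proof -
  have B: "1 + bcost b \<le> (1 + bcost b) * B ^ d"
    using assms(1) by (rule le_mult_power)
  show ?thesis
  proof (cases "bval b s")
    case True
    then obtain t s' where 1: "exec c1 s t s'" "t \<le> coef c1 * B ^ d" "Q s'"
      using assms(2) unfolding runs_def by blast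
    have "1 + bcost b + t \<le> coef (If b c1 c2) * B ^ d"
      using B 1(2) unfolding coef.simps add_mult_distrib by linarith
    with exec.IfTrue[OF True 1(1)] 1(3) show ?thesis
      unfolding runs_def by blast
  next
    case False
    then obtain t s' where 1: "exec c2 s t s'" "t \<le> coef c2 * B ^ d" "Q s'"
      using assms(3) unfolding runs_def by blast
    have "1 + bcost b + t \<le> coef (If b c1 c2) * B ^ d"
      using B 1(2) unfolding coef.simps add_mult_distrib by linarith
    with exec.IfFalse[OF False 1(1)] 1(3) show ?thesis
      unfolding runs_def by blast
  qed
qed

section \<open>Loop-free programs\<close>

fun loop_free :: "com \<Rightarrow> bool" where
  "loop_free (Seq c1 c2) \<longleftrightarrow> loop_free c1 \<and> loop_free c2"
| "loop_free (If b c1 c2) \<longleftrightarrow> loop_free c1 \<and> loop_free c2"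
| "loop_free (While b c) \<longleftrightarrow> False"
| "loop_free c \<longleftrightarrow> True"

text \<open>On loop-free programs execution is a function that the simplifier can compute. The last
  equation gives \<open>While\<close> a dummy value, a case that \<open>runs_loop_free\<close>
  excludes.\<close>

fun result :: "com \<Rightarrow> state \<Rightarrow> state" where
  "result (Assign x i a) s = s(x := (s x)(aval i s := aval a s))"
| "result (Seq c1 c2) s = result c2 (result c1 s)"
| "result (If b c1 c2) s = (if bval b s then result c1 s else result c2 s)"
| "result c s = s"

lemma runs_loop_free:
  assumes "loop_free c" and "0 < B" and "Q (result c s)"
  shows "runs B d c s Q"
  using assms
proof (induction c arbitrary: s Q)
  case SKIP
  have "1 \<le> coef SKIP * B ^ d"
    using SKIP by (simp add: Suc_le_eq)
  with exec.Skip SKIP show ?case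
    unfolding runs_def by fastforce
next
  case (Assign x i a)
  have "1 + acost i + acost a \<le> coef (Assign x i a) * B ^ d"
    unfolding coef.simps by (rule le_mult_power) (rule Assign)
  with exec.Assign Assign(3) show ?case
    unfolding runs_def result.simps by blast
next
  case (Seq c1 c2)
  have "runs B d c1 s (\<lambda>s'. s' = result c1 s)"
    using Seq by simp
  then show ?case
    by (rule runs_Seq) (use Seq in simp)
next
  case (If b c1 c2)
  show ?case
    by (rule runs_If) (use If in simp_all)
qed simp

section \<open>Counting loops\<close>

definition For :: "vname \<Rightarrow> aexp \<Rightarrow> com \<Rightarrow> com" where
  "For x b c = Assign x (N 0) (N 0) ;;
     While (Less (Cell x (N 0)) b) (c ;; Assign x (N 0) (Plus (Cell x (N 0)) (N 1)))"

lemma writes_For [simp]: "writes (For x b c) = insert x (writes c)"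
  by (auto simp: For_def)

text \<open>The body runs \<open>n\<close> times and the guard \<open>n + 1\<close> times, so
  \<open>n < B ^ j\<close> lets \<open>B ^ j\<close> passes pay for everything. The exponent
  \<open>j\<close> admits a single loop of quadratic length. Resetting and advancing the counter
  must not disturb the invariant, hence \<open>insens\<close>; the value of the counter reaches
  \<open>I\<close> as its first argument instead.\<close>

lemma runs_For:
  assumes B: "0 < B" and n: "n < B ^ j"
    and x: "x \<notin> writes c"
    and bound: "\<And>s'. agree (insert x (writes c)) s s' \<Longrightarrow> aval b s' = n"
    and insens: "\<And>i s' v. I i s' \<Longrightarrow> I i (s'(x := v))"
    and init: "I 0 s"
    and body: "\<And>i s'. \<lbrakk>i < n; s' x 0 = i; agree (insert x (writes c)) s s'; I i s'\<rbrakk>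
      \<Longrightarrow> runs B d c s' (I (Suc i))"
  shows "runs B (d + j) (For x b c) s (I n)"
proof -
  let ?inc = "Assign x (N 0) (Plus (Cell x (N 0)) (N 1))"
  let ?w = "While (Less (Cell x (N 0)) b) (c ;; ?inc)"
  let ?g = "Less (Cell x (N 0)) b"
  have pos: "0 < B ^ d * B ^ j"
    using B by simp
  have Bd: "1 \<le> B ^ d"
    using pos by (simp add: Suc_le_eq)
  let ?K = "1 + bcost ?g + coef (c ;; ?inc)"
  \<comment> \<open>The factor \<open>Suc n - i\<close> counts the remaining passes and one more for
    the failing guard, each charged the full \<open>?K * B ^ d\<close>.\<close>
  have loop: "\<exists>t s''. exec ?w s' t s'' \<and> t \<le> (Suc n - i) * (?K * B ^ d) \<and> I n s''"
    if "i \<le> n" "s' x 0 = i" "agree (insert x (writes c)) s s'" "I i s'" for i s'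
    using that
  proof (induction "n - i" arbitrary: i s')
    case 0
    then have i: "i = n" by simp
    have "\<not> bval ?g s'"
      using 0 i bound by simp
    from exec.WhileFalse[OF this] have "exec ?w s' (1 + bcost ?g) s'" .
    moreover have "1 + bcost ?g \<le> (Suc n - i) * (?K * B ^ d)"
    proof -
      have "1 + bcost ?g \<le> ?K * 1" by simp
      also have "\<dots> \<le> ?K * B ^ d" using Bd by (intro mult_le_mono) auto
      finally show ?thesis using i by simp
    qed
    ultimately show ?case using 0 i by blast
  next
    case (Suc m)
    then have lt: "i < n" by simp
    have g: "bval ?g s'"
      using Suc lt bound by simp
    have "runs B d c s' (I (Suc i))"
      by (rule body) (use Suc lt in auto)
    then obtain t1 s1 where 1: "exec c s' t1 s1" "t1 \<le> coef c * B ^ d" "I (Suc i) s1"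
      unfolding runs_def by blast
    have s1x: "s1 x = s' x"
      using exec_agree[OF 1(1)] x by (simp add: agree_def)
    define s2 where "s2 = s1(x := (s1 x)(0 := Suc i))"
    have inc: "exec ?inc s1 (1 + acost (N 0) + acost (Plus (Cell x (N 0)) (N 1))) s2"
      using exec.Assign[of x "N 0" "Plus (Cell x (N 0)) (N 1)" s1] s1x Suc.prems(2)
      by (simp add: s2_def)
    have ag: "agree (insert x (writes c)) s s2"
      using Suc.prems(3) exec_agree[OF 1(1)] by (auto simp: agree_def s2_def)
    have "\<exists>t s''. exec ?w s2 t s'' \<and> t \<le> (Suc n - Suc i) * (?K * B ^ d) \<and> I n s''"
      by (rule Suc.hyps(1)) (use Suc lt ag insens[OF 1(3)] in \<open>auto simp: s2_def\<close>)
    then obtain t2 s3 where 2: "exec ?w s2 t2 s3" "t2 \<le> (n - i) * (?K * B ^ d)" "I n s3"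
      by auto
    have ex: "exec ?w s' (1 + bcost ?g + (t1 + (1 + acost (N 0) + acost (Plus (Cell x (N 0)) (N 1)))) + t2) s3"
      by (rule exec.WhileTrue[OF g exec.Seq[OF 1(1) inc] 2(1)])
    have inc_le: "1 + bcost ?g + coef ?inc \<le> (1 + bcost ?g + coef ?inc) * B ^ d"
      using B by (rule le_mult_power)
    have "1 + bcost ?g + (t1 + (1 + acost (N 0) + acost (Plus (Cell x (N 0)) (N 1))))
        \<le> coef c * B ^ d + (1 + bcost ?g + coef ?inc) * B ^ d"
      using inc_le 1(2) unfolding coef.simps by linarith
    also have "\<dots> = ?K * B ^ d"
      by (simp add: algebra_simps)
    finally have "1 + bcost ?g + (t1 + (1 + acost (N 0) + acost (Plus (Cell x (N 0)) (N 1)))) + t2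
        \<le> ?K * B ^ d + (n - i) * (?K * B ^ d)"
      using 2(2) by linarith
    also have "\<dots> = (Suc n - i) * (?K * B ^ d)"
      using lt by (simp add: Suc_diff_le)
    finally show ?case
      using ex 2(3) by blast
  qed
  define s0 where "s0 = s(x := (s x)(0 := 0))"
  have i0: "exec (Assign x (N 0) (N 0)) s (1 + acost (N 0) + acost (N 0)) s0"
    using exec.Assign[of x "N 0" "N 0" s] by (simp add: s0_def)
  have "agree (insert x (writes c)) s s0"
    by (simp add: agree_def s0_def)
  from loop[of 0 s0, OF _ _ this] obtain t s'
    where 1: "exec ?w s0 t s'" "t \<le> Suc n * (?K * B ^ d)" "I n s'"
    using insens[OF init] by (auto simp: s0_def)
  have "t \<le> B ^ j * (?K * B ^ d)"
    using 1(2) n by (meson Suc_leI le_trans mult_le_mono1)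
  also have "\<dots> = ?K * B ^ (d + j)"
    by (simp only: power_add ac_simps)
  finally have t: "t \<le> ?K * B ^ (d + j)" .
  have "1 + acost (N 0) + acost (N 0) \<le> coef (Assign x (N 0) (N 0)) * B ^ (d + j)"
    unfolding coef.simps by (rule le_mult_power) (rule B)
  then have "1 + acost (N 0) + acost (N 0) + t \<le> coef (For x b c) * B ^ (d + j)"
    using t unfolding For_def coef.simps(3)[of "Assign x (N 0) (N 0)"] coef.simps(5) add_mult_distrib
    by linarith
  with exec.Seq[OF i0 1(1)] 1(3) show ?thesis
    unfolding runs_def For_def by blast
qed

text \<open>The inner bound may depend on the outer index, as in loops over pairs
  \<open>j < i\<close> or over the copies of an edge. The invariant follows the lexicographic order
  of the pairs, and \<open>carry\<close> identifies the end of a row with the beginning of the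
  next.\<close>

lemma runs_For2:
  assumes n: "n < B" and m: "\<And>i. i < n \<Longrightarrow> m i < B"
    and xy: "x \<notin> writes c" "y \<notin> writes c" "x \<noteq> y"
    and b1: "\<And>s'. agree (insert x (insert y (writes c))) s s' \<Longrightarrow> aval b1 s' = n"
    and b2: "\<And>i s'. \<lbrakk>i < n; s' x 0 = i; agree (insert x (insert y (writes c))) s s'\<rbrakk> \<Longrightarrow> aval b2 s' = m i"
    and insens: "\<And>i j s' v. I i j s' \<Longrightarrow> I i j (s'(x := v))" "\<And>i j s' v. I i j s' \<Longrightarrow> I i j (s'(y := v))"
    and init: "I 0 0 s"
    and body: "\<And>i j s'. \<lbrakk>i < n; j < m i; s' x 0 = i; s' y 0 = j;
        agree (insert x (insert y (writes c))) s s'; I i j s'\<rbrakk> \<Longrightarrow> runs B d c s' (I i (Suc j))"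
    and carry: "\<And>i s'. \<lbrakk>i < n; I i (m i) s'\<rbrakk> \<Longrightarrow> I (Suc i) 0 s'"
  shows "runs B (d + 2) (For x b1 (For y b2 c)) s (I n 0)"
proof -
  have "runs B ((d + 1) + 1) (For x b1 (For y b2 c)) s (\<lambda>s'. I n 0 s')"
  proof (rule runs_For[where I = "\<lambda>i. I i 0" and n = n])
    show "0 < B" using n by simp
    show "n < B ^ 1" using n by simp
    show "x \<notin> writes (For y b2 c)" using xy by simp
    show "aval b1 s' = n" if "agree (insert x (writes (For y b2 c))) s s'" for s'
      using b1 that by simp
    show "I i 0 (s'(x := v))" if "I i 0 s'" for i s' v
      using insens that by blast
    show "I 0 0 s" by (rule init)
    fix i s'
    assume i: "i < n" "s' x 0 = i" and ag: "agree (insert x (writes (For y b2 c))) s s'" and I: "I i 0 s'"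
    have "runs B (d + 1) (For y b2 c) s' (I i (m i))"
    proof (rule runs_For[where I = "I i" and n = "m i"])
      show "0 < B" using n by simp
      show "m i < B ^ 1" using m i by simp
      show "y \<notin> writes c" using xy by simp
      show "aval b2 s'' = m i" if a: "agree (insert y (writes c)) s' s''" for s''
      proof (rule b2)
        show "i < n" by (rule i)
        show "s'' x 0 = i" using a xy i by (auto simp: agree_def)
        show "agree (insert x (insert y (writes c))) s s''"
          by (rule agree_trans[OF ag a]) auto
      qed
      show "I i j (s''(y := v))" if "I i j s''" for j s'' v
        using insens that by blast
      show "I i 0 s'" by (rule I)
      show "runs B d c s'' (I i (Suc j))" if a: "j < m i" "s'' y 0 = j" "agree (insert y (writes c)) s' s''" "I i j s''" for j s''
      proof (rule body)
        show "s'' x 0 = i" using a xy i by (auto simp: agree_def)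
        show "agree (insert x (insert y (writes c))) s s''"
          by (rule agree_trans[OF ag a(3)]) auto
      qed (use a i in auto)
    qed
    then show "runs B (d + 1) (For y b2 c) s' (I (Suc i) 0)"
      by (rule runs_conseq) (use carry i in blast)
  qed
  then show ?thesis by simp
qed


section \<open>Isomorphisms of powers and line graphs\<close>

lemma graph_iso_comp:
  assumes f: "graph_iso f X Y" and g: "graph_iso g Y Z"
  shows "graph_iso (g \<circ> f) X Z"
proof -
  have "f u \<in> verts Y" if "u \<in> verts X" for u
    using f that by (auto simp: graph_iso_def bij_betw_def)
  with f g show ?thesis
    unfolding graph_iso_def by (auto intro: bij_betw_trans)
qed

lemma graph_iso_inv:
  assumes f: "graph_iso f X Y"
  shows "graph_iso (inv_into (verts X) f) Y X"
proof -
  have b: "bij_betw f (verts X) (verts Y)"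
    using f by (simp add: graph_iso_def)
  have "inv_into (verts X) f u \<in> verts X \<and> f (inv_into (verts X) f u) = u" if "u \<in> verts Y" for u
    using b that by (metis bij_betw_def f_inv_into_f inv_into_into)
  with f bij_betw_inv_into[OF b] show ?thesis
    unfolding graph_iso_def by metis
qed

lemma isomorphic_sym: "isomorphic X Y \<Longrightarrow> isomorphic Y X"
  unfolding isomorphic_def using graph_iso_inv by blast

lemma isomorphic_trans: "isomorphic X Y \<Longrightarrow> isomorphic Y Z \<Longrightarrow> isomorphic X Z"
  unfolding isomorphic_def using graph_iso_comp by blast

section \<open>Distances and powers of the adjacency relation\<close>

definition adj :: "'v graph \<Rightarrow> ('v \<times> 'v) set" where
  "adj X = {(u, v). u \<in> verts X \<and> v \<in> verts X \<and> {u, v} \<in> edges X}"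

lemma sym_adj: "sym (adj X)"
  by (auto simp: adj_def sym_def insert_commute)

lemma sym_relpow: "sym R \<Longrightarrow> sym (R ^^ l)"
proof (induction l)
  case (Suc l)
  then show ?case
    unfolding sym_def by (metis relpow_Suc_D2 relpow_Suc_I)
qed (auto simp: sym_def)

text \<open>A walk, read as a function on positions, is a chain in the sense of
  \<open>relpow_fun_conv\<close>. The hypothesis on \<open>u\<close> matters for
  \<open>l = 0\<close>: the zeroth power relates every value to itself, while a walk stays among the
  vertices.\<close>

lemma walk_iff_relpow:
  assumes "u \<in> verts X"
  shows "(\<exists>p. walk X p \<and> hd p = u \<and> last p = v \<and> length p = Suc l) \<longleftrightarrow> (u, v) \<in> adj X ^^ l"
proof
  assume "\<exists>p. walk X p \<and> hd p = u \<and> last p = v \<and> length p = Suc l"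
  then obtain p where p: "walk X p" "hd p = u" "last p = v" "length p = Suc l" by blast
  have "p ! i \<in> verts X" if "i < length p" for i
    using p(1) that by (auto simp: walk_def)
  then have "(p ! i, p ! Suc i) \<in> adj X" if "i < l" for i
    using p that by (simp add: walk_def adj_def)
  moreover have "p ! 0 = u" "p ! l = v"
    using p by (auto simp: walk_def hd_conv_nth last_conv_nth)
  ultimately show "(u, v) \<in> adj X ^^ l"
    unfolding relpow_fun_conv by blast
next
  assume "(u, v) \<in> adj X ^^ l"
  then obtain f where f: "f 0 = u" "f l = v" "\<forall>i<l. (f i, f (Suc i)) \<in> adj X"
    unfolding relpow_fun_conv by blast
  let ?p = "map f [0..<Suc l]"
  have "f i \<in> verts X" if "i < Suc l" for i
    using f assms that by (cases i) (auto simp: adj_def)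
  then have "set ?p \<subseteq> verts X"
    by auto
  moreover have "{?p ! i, ?p ! Suc i} \<in> edges X" if "Suc i < length ?p" for i
    using f(3) that by (simp add: adj_def nth_append del: upt_Suc)
  moreover have "hd ?p = u" "last ?p = v"
    using f by (auto simp: hd_map last_map hd_append)
  ultimately have "walk X ?p \<and> hd ?p = u \<and> last ?p = v \<and> length ?p = Suc l"
    by (simp add: walk_def)
  then show "\<exists>p. walk X p \<and> hd p = u \<and> last p = v \<and> length p = Suc l"
    by blast
qed

lemma Inf_enat_le_iff: "Inf A \<le> enat t \<longleftrightarrow> (\<exists>a\<in>A. a \<le> enat t)"
proof
  assume *: "Inf A \<le> enat t"
  then have "A \<noteq> {}"
    by (auto simp: Inf_enat_def)
  then have "Inf A \<in> A"
    by (auto simp: Inf_enat_def intro: LeastI)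
  with * show "\<exists>a\<in>A. a \<le> enat t"
    by blast
qed (meson Inf_lower order_trans)

lemma distance_le_iff:
  assumes "u \<in> verts X"
  shows "distance X u v \<le> enat t \<longleftrightarrow> (\<exists>l\<le>t. (u, v) \<in> adj X ^^ l)"
proof -
  have "distance X u v \<le> enat t \<longleftrightarrow> (\<exists>p. walk X p \<and> hd p = u \<and> last p = v \<and> length p - 1 \<le> t)"
    unfolding distance_def Inf_enat_le_iff by auto
  also have "\<dots> \<longleftrightarrow> (\<exists>l\<le>t. \<exists>p. walk X p \<and> hd p = u \<and> last p = v \<and> length p = Suc l)"
    by (metis Suc_pred' diff_Suc_1 length_greater_0_conv walk_def)
  finally show ?thesis
    using walk_iff_relpow[OF assms] by blast
qed

lemma verts_graph_power [simp]: "verts (graph_power X t) = verts X"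
  by (simp add: graph_power_def)

lemma graph_power_edge_iff:
  "{u, v} \<in> edges (graph_power X t) \<longleftrightarrow>
    u \<in> verts X \<and> v \<in> verts X \<and> u \<noteq> v \<and> (\<exists>l\<le>t. (u, v) \<in> adj X ^^ l)"
proof -
  have sym: "(u, v) \<in> adj X ^^ l \<longleftrightarrow> (v, u) \<in> adj X ^^ l" for l
    using sym_relpow[OF sym_adj[of X], of l] by (auto simp: sym_def)
  \<comment> \<open>An unordered pair is an edge as soon as one of its two orders satisfies the
    bound; symmetry of the powers removes the choice.\<close>
  have "{u, v} \<in> edges (graph_power X t) \<longleftrightarrow> u \<in> verts X \<and> v \<in> verts X \<and> u \<noteq> v \<and>
      (distance X u v \<le> enat t \<or> distance X v u \<le> enat t)"
    by (auto simp: graph_power_def doubleton_eq_iff)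
  also have "\<dots> \<longleftrightarrow> u \<in> verts X \<and> v \<in> verts X \<and> u \<noteq> v \<and> (\<exists>l\<le>t. (u, v) \<in> adj X ^^ l)"
    using distance_le_iff[of u X v t] distance_le_iff[of v X u t] by (simp only: sym) blast
  finally show ?thesis .
qed

lemma graph_iso_relpow:
  assumes f: "graph_iso f X Y" and "(u, v) \<in> adj X ^^ l"
  shows "(f u, f v) \<in> adj Y ^^ l"
proof -
  have "(f a, f b) \<in> adj Y" if "(a, b) \<in> adj X" for a b
    using f that by (auto simp: adj_def graph_iso_def bij_betw_def)
  with assms(2) show ?thesis
    by (induction l arbitrary: v) (auto simp: relcomp_unfold)
qed

lemma graph_iso_power:
  assumes f: "graph_iso f X Y"
  shows "graph_iso f (graph_power X t) (graph_power Y t)"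
proof -
  have b: "bij_betw f (verts X) (verts Y)"
    using f by (simp add: graph_iso_def)
  have inv: "inv_into (verts X) f (f u) = u" if "u \<in> verts X" for u
    using b that by (simp add: bij_betw_def)
  have "(f u, f v) \<in> adj Y ^^ l \<longleftrightarrow> (u, v) \<in> adj X ^^ l" if "u \<in> verts X" "v \<in> verts X" for u v l
    using graph_iso_relpow[OF f, of u v l] graph_iso_relpow[OF graph_iso_inv[OF f], of "f u" "f v" l]
      inv that by auto
  moreover have "f u = f v \<longleftrightarrow> u = v" "f u \<in> verts Y" if "u \<in> verts X" "v \<in> verts X" for u v
    using b that by (auto simp: bij_betw_def inj_on_def)
  ultimately show ?thesis
    using b unfolding graph_iso_def graph_power_edge_iff verts_graph_power by simp
qed

section \<open>Line graphs and their isomorphisms\<close>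

lemma verts_line_graph [simp]: "verts (line_graph X) = edges X"
  by (simp add: line_graph_def)

lemma line_graph_edge_iff:
  "{e, f} \<in> edges (line_graph X) \<longleftrightarrow> e \<in> edges X \<and> f \<in> edges X \<and> e \<noteq> f \<and> e \<inter> f \<noteq> {}"
  by (auto simp: line_graph_def doubleton_eq_iff)

lemma simple_graph_edgeE:
  assumes "simple_graph X" and "e \<in> edges X"
  obtains u v where "e = {u, v}" "u \<noteq> v" "u \<in> verts X" "v \<in> verts X"
proof -
  have e: "e \<subseteq> verts X" "card e = 2"
    using assms by (auto simp: simple_graph_def)
  then obtain u v where "e = {u, v}" "u \<noteq> v"
    by (auto simp: card_2_iff)
  with e(1) show ?thesis
    by (intro that) auto
qed

text \<open>An isomorphism acts on edges by taking images. Injectivity on the vertices makes images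
  commute with intersections, so two edges meet if and only if their images do.\<close>

lemma graph_iso_line_graph:
  assumes X: "simple_graph X" and Y: "simple_graph Y" and f: "graph_iso f X Y"
  shows "graph_iso (image f) (line_graph X) (line_graph Y)"
proof -
  have b: "bij_betw f (verts X) (verts Y)" and inj: "inj_on f (verts X)"
    using f by (auto simp: graph_iso_def bij_betw_def)
  have sub: "e \<subseteq> verts X" if "e \<in> edges X" for e
    using X that by (simp add: simple_graph_def)
  have injE: "f ` e = f ` e' \<longleftrightarrow> e = e'" if "e \<in> edges X" "e' \<in> edges X" for e e'
    using inj_on_image_eq_iff[OF inj] sub that by blast
  have img: "f ` e \<in> edges Y" if "e \<in> edges X" for e
    using X that by (rule simple_graph_edgeE) (use f that in \<open>auto simp: graph_iso_def\<close>)
  have "e \<in> image f ` edges X" if "e \<in> edges Y" for e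
    using Y that
  proof (rule simple_graph_edgeE)
    fix a b
    assume e: "e = {a, b}" and "a \<in> verts Y" "b \<in> verts Y"
    then obtain u v where "u \<in> verts X" "v \<in> verts X" "f u = a" "f v = b"
      using b by (metis bij_betw_def imageE)
    then have "{u, v} \<in> edges X" "e = f ` {u, v}"
      using f that e by (auto simp: graph_iso_def)
    then show ?thesis by blast
  qed
  then have "bij_betw (image f) (edges X) (edges Y)"
    using img injE by (auto simp: bij_betw_def inj_on_def)
  moreover have "{e, e'} \<in> edges (line_graph X) \<longleftrightarrow> {f ` e, f ` e'} \<in> edges (line_graph Y)"
    if "e \<in> edges X" "e' \<in> edges X" for e e'
  proof -
    have "f ` e \<inter> f ` e' = f ` (e \<inter> e')"
      using inj_on_image_Int[OF inj] sub that by blast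
    then show ?thesis
      using img[OF that(1)] img[OF that(2)] injE[OF that] that by (simp add: line_graph_edge_iff)
  qed
  ultimately show ?thesis
    unfolding graph_iso_def verts_line_graph by simp
qed

text \<open>The edges of a graph are the vertices of its line graph, so the required bijection is
  part of the isomorphism of line graphs.\<close>

lemma graph_iso_card_edges:
  assumes "simple_graph X" and "simple_graph Y" and "graph_iso f X Y"
  shows "card (edges X) = card (edges Y)"
proof -
  have "bij_betw (image f) (verts (line_graph X)) (verts (line_graph Y))"
    using graph_iso_line_graph[OF assms] unfolding graph_iso_def by blast
  then have "card (verts (line_graph X)) = card (verts (line_graph Y))"
    by (rule bij_betw_same_card)
  then show ?thesis
    by simp
qed

lemma isomorphic_conflict_graph:
  assumes "simple_graph X" and "simple_graph Y" and "isomorphic X Y"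
  shows "isomorphic (conflict_graph X M) (conflict_graph Y M)"
proof -
  obtain f where "graph_iso f X Y"
    using assms(3) by (auto simp: isomorphic_def)
  from graph_iso_power[OF graph_iso_line_graph[OF assms(1,2) this]] show ?thesis
    unfolding isomorphic_def conflict_graph_def by blast
qed


section \<open>True twins and line multigraphs\<close>

lemma simple_graph_card_edges_le:
  assumes "simple_graph X"
  shows "card (edges X) \<le> card (verts X) * card (verts X)"
proof -
  have fin: "finite (verts X \<times> verts X)"
    using assms by (simp add: simple_graph_def)
  have "edges X \<subseteq> (\<lambda>(u, v). {u, v}) ` (verts X \<times> verts X)"
    using assms by (auto elim!: simple_graph_edgeE)
  then have "card (edges X) \<le> card (verts X \<times> verts X)"
    using fin by (meson card_image_le card_mono finite_imageI le_trans)
  then show ?thesis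
    by (simp add: card_cartesian_product)
qed

section \<open>Twin classes and the contracted graph\<close>

lemma closed_nbhd_iff:
  "v \<in> verts X \<Longrightarrow> v \<in> closed_nbhd X u \<longleftrightarrow> v = u \<or> {u, v} \<in> edges X"
  by (auto simp: closed_nbhd_def)

text \<open>Equal closed neighbourhoods of distinct vertices force adjacency, as each vertex lies in
  its own. So twin classes are the fibres of \<open>closed_nbhd\<close> and can be compared by
  comparing neighbourhoods.\<close>

lemma twin_class_eq:
  assumes "u \<in> verts X"
  shows "twin_class X u = {v \<in> verts X. closed_nbhd X v = closed_nbhd X u}"
proof -
  have "v = u \<or> true_twins X u v \<longleftrightarrow> closed_nbhd X v = closed_nbhd X u" if "v \<in> verts X" for v
  proof -
    have "v \<in> closed_nbhd X v"
      by (simp add: closed_nbhd_def)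
    then show ?thesis
      using closed_nbhd_iff[OF that, of u] by (auto simp: true_twins_def)
  qed
  then show ?thesis
    by (auto simp: twin_class_def)
qed

lemma twin_class_eq_iff:
  assumes "u \<in> verts X" and "v \<in> verts X"
  shows "twin_class X u = twin_class X v \<longleftrightarrow> closed_nbhd X u = closed_nbhd X v"
  using assms by (auto simp: twin_class_eq)

text \<open>Edges of the contraction are defined through some pair of representatives; adjacency
  between different classes does not depend on that pair.\<close>

lemma contraction_edge_iff:
  assumes "u \<in> verts X" and "v \<in> verts X"
  shows "{twin_class X u, twin_class X v} \<in> edges (contraction X) \<longleftrightarrow>
    {u, v} \<in> edges X \<and> twin_class X u \<noteq> twin_class X v"
proof
  have key: "{u, v} \<in> edges X \<and> twin_class X u \<noteq> twin_class X v"
    if ab: "a \<in> verts X" "b \<in> verts X" "{a, b} \<in> edges X" "twin_class X a \<noteq> twin_class X b"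
      and "twin_class X u = twin_class X a" "twin_class X v = twin_class X b" for a b
  proof -
    have eq: "closed_nbhd X u = closed_nbhd X a" "closed_nbhd X v = closed_nbhd X b"
      using that assms twin_class_eq_iff by metis+
    \<comment> \<open>Replace \<open>a\<close> by \<open>u\<close> in one neighbourhood and, after
      exchanging the roles of the ends, \<open>b\<close> by \<open>v\<close> in the other.\<close>
    have "b \<in> closed_nbhd X u"
      using ab closed_nbhd_iff eq by metis
    then have "u \<in> closed_nbhd X v"
      using ab assms closed_nbhd_iff eq by (metis insert_commute)
    then show ?thesis
      using that assms closed_nbhd_iff by (metis insert_commute)
  qed
  assume "{twin_class X u, twin_class X v} \<in> edges (contraction X)"
  then obtain a b where ab: "a \<in> verts X" "b \<in> verts X" "{a, b} \<in> edges X"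
      "twin_class X a \<noteq> twin_class X b" "{twin_class X u, twin_class X v} = {twin_class X a, twin_class X b}"
    unfolding contraction_def by auto
  have "{b, a} \<in> edges X"
    using ab(3) by (simp add: insert_commute)
  from ab(5) consider "twin_class X u = twin_class X a" "twin_class X v = twin_class X b"
    | "twin_class X u = twin_class X b" "twin_class X v = twin_class X a"
    unfolding doubleton_eq_iff by blast
  then show "{u, v} \<in> edges X \<and> twin_class X u \<noteq> twin_class X v"
  proof cases
    case 1
    then show ?thesis by (intro key[OF ab(1-4)])
  next
    case 2
    then show ?thesis by (intro key[OF ab(2,1) \<open>{b, a} \<in> edges X\<close> ab(4)[symmetric]])
  qed
qed (use assms in \<open>auto simp: contraction_def\<close>)

text \<open>Turns an isomorphism onto a graph of classes into a quotient map \<open>q\<close> with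
  fibres \<open>f k\<close>, which is all that the two root constructions need. \<open>H\<close> is
  not assumed simple; it has no loops because the contraction has none and \<open>graph_iso\<close>
  also compares the sets \<open>{k, k}\<close>.\<close>

lemma contraction_iso_quotient:
  assumes f: "graph_iso f H (contraction X)"
  obtains q where
    "\<And>u. u \<in> verts X \<Longrightarrow> q u \<in> verts H"
    "\<And>k. k \<in> verts H \<Longrightarrow> f k = {u \<in> verts X. q u = k}"
    "\<And>k. k \<in> verts H \<Longrightarrow> f k \<noteq> {}"
    "\<And>u v. u \<in> verts X \<Longrightarrow> v \<in> verts X \<Longrightarrow> u \<noteq> v \<Longrightarrow>
       {u, v} \<in> edges X \<longleftrightarrow> q u = q v \<or> {q u, q v} \<in> edges H"
    "\<And>u v. u \<in> verts X \<Longrightarrow> v \<in> verts X \<Longrightarrow> closed_nbhd X u = closed_nbhd X v \<Longrightarrow> q u = q v"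
    "\<And>k. k \<in> verts H \<Longrightarrow> {k} \<notin> edges H"
proof
  let ?q = "\<lambda>u. inv_into (verts H) f (twin_class X u)"
  have b: "bij_betw f (verts H) (twin_class X ` verts X)"
    using f by (simp add: graph_iso_def contraction_def)
  have q: "?q u \<in> verts H" "f (?q u) = twin_class X u" if "u \<in> verts X" for u
    using b that by (auto simp: bij_betw_def inv_into_into f_inv_into_f)
  have q_eq: "?q u = ?q v \<longleftrightarrow> twin_class X u = twin_class X v" if "u \<in> verts X" "v \<in> verts X" for u v
    using q that by metis
  have edge: "{k, l} \<in> edges H \<longleftrightarrow> {f k, f l} \<in> edges (contraction X)" if "k \<in> verts H" "l \<in> verts H" for k l
    using f that by (simp add: graph_iso_def)
  show "?q u \<in> verts H" if "u \<in> verts X" for u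
    using q that by blast
  show "f k = {u \<in> verts X. ?q u = k}" if k: "k \<in> verts H" for k
  proof -
    obtain u where u: "u \<in> verts X" "f k = twin_class X u"
      using bij_betw_apply[OF b k] by auto
    have "?q v = k \<longleftrightarrow> closed_nbhd X v = closed_nbhd X u" if "v \<in> verts X" for v
      using b k u q[OF that] twin_class_eq_iff[OF that u(1)] by (metis bij_betw_inv_into_left)
    then show ?thesis
      unfolding u(2) twin_class_eq[OF u(1)] by (intro Collect_cong) blast
  qed
  show "f k \<noteq> {}" if "k \<in> verts H" for k
    using bij_betw_apply[OF b that] by (auto simp: twin_class_def)
  show "{u, v} \<in> edges X \<longleftrightarrow> ?q u = ?q v \<or> {?q u, ?q v} \<in> edges H"
    if uv: "u \<in> verts X" "v \<in> verts X" and ne: "u \<noteq> v" for u v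
  proof (cases "twin_class X u = twin_class X v")
    case True
    then have "u \<in> closed_nbhd X v"
      using uv twin_class_eq_iff by (metis closed_nbhd_iff)
    then have "{u, v} \<in> edges X"
      using uv ne closed_nbhd_iff by (metis insert_commute)
    then show ?thesis
      using True by simp
  next
    case False
    then show ?thesis
      using edge[OF q(1)[OF uv(1)] q(1)[OF uv(2)]] q_eq[OF uv] contraction_edge_iff[OF uv] q(2) uv
      by simp
  qed
  show "?q u = ?q v" if "u \<in> verts X" "v \<in> verts X" "closed_nbhd X u = closed_nbhd X v" for u v
    using twin_class_eq_iff[OF that(1,2)] that(3) by simp
  show "{k} \<notin> edges H" if "k \<in> verts H" for k
  proof
    assume "{k} \<in> edges H"
    then have "{f k, f k} \<in> edges (contraction X)"
      using edge[OF that that] by simp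
    then show False
      by (auto simp: contraction_def doubleton_eq_iff)
  qed
qed

section \<open>Roots of a graph and roots of its contraction\<close>

lemma line_graph_of_multigraph_edge_iff:
  "{e, f} \<in> edges (line_graph_of_multigraph G) \<longleftrightarrow>
    e \<in> medges G \<and> f \<in> medges G \<and> e \<noteq> f \<and> ends G e \<inter> ends G f \<noteq> {}"
  by (auto simp: line_graph_of_multigraph_def doubleton_eq_iff)

text \<open>Send copy number \<open>l\<close> of the root edge \<open>r k\<close> to the
  \<open>l\<close>-th member of the class \<open>f k\<close>. Two different copies meet if and only
  if they come from the same root edge, which is nonempty, or from root edges that meet; in
  \<open>X\<close> these cases are members of one class and members of adjacent classes.\<close>

lemma line_graph_multiplied_root:
  assumes X: "simple_graph X" and f: "graph_iso f H (contraction X)"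
    and Y: "simple_graph Y" and r: "graph_iso r H (line_graph Y)"
    and Z: "mverts Z = verts Y" "finite (medges Z)"
    and \<beta>: "bij_betw \<beta> (medges Z) (SIGMA k:verts H. {..<card (f k)})"
    and ends: "\<And>j. j \<in> medges Z \<Longrightarrow> ends Z j = r (fst (\<beta> j))"
  shows "multigraph Z \<and> isomorphic (line_graph_of_multigraph Z) X"
proof -
  obtain q where q: "\<And>u. u \<in> verts X \<Longrightarrow> q u \<in> verts H"
    and fq: "\<And>k. k \<in> verts H \<Longrightarrow> f k = {u \<in> verts X. q u = k}"
    and "\<And>k. k \<in> verts H \<Longrightarrow> f k \<noteq> {}"
    and edge: "\<And>u v. u \<in> verts X \<Longrightarrow> v \<in> verts X \<Longrightarrow> u \<noteq> v \<Longrightarrow>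
       {u, v} \<in> edges X \<longleftrightarrow> q u = q v \<or> {q u, q v} \<in> edges H"
    and "\<And>u v. u \<in> verts X \<Longrightarrow> v \<in> verts X \<Longrightarrow> closed_nbhd X u = closed_nbhd X v \<Longrightarrow> q u = q v"
    and "\<And>k. k \<in> verts H \<Longrightarrow> {k} \<notin> edges H"
    by (rule contraction_iso_quotient[OF f]) (rule that)
  have rE: "r k \<in> edges Y" if "k \<in> verts H" for k
    using r that by (auto simp: graph_iso_def bij_betw_def line_graph_def)
  have r2: "r k \<subseteq> verts Y" "card (r k) = 2" if "k \<in> verts H" for k
    using Y rE[OF that] by (auto simp: simple_graph_def)
  have \<beta>H: "fst (\<beta> j) \<in> verts H" if "j \<in> medges Z" for j
    using bij_betw_apply[OF \<beta> that] by auto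
  have "multigraph Z"
    using Y Z r2 \<beta>H ends by (simp add: multigraph_def simple_graph_def)
  \<comment> \<open>An arbitrary enumeration of each class turns copy numbers into members.\<close>
  have "\<exists>g. bij_betw g {..<card (f k)} (f k)" if "k \<in> verts H" for k
    using X fq[OF that] ex_bij_betw_nat_finite[of "f k"] by (simp add: simple_graph_def atLeast0LessThan)
  then obtain g where g: "\<And>k. k \<in> verts H \<Longrightarrow> bij_betw (g k) {..<card (f k)} (f k)"
    by metis
  let ?\<gamma> = "\<lambda>(k, l). g k l"
  have gq: "g k l \<in> verts X \<and> q (g k l) = k" if "k \<in> verts H" "l < card (f k)" for k l
    using bij_betw_apply[OF g[OF that(1)]] fq[OF that(1)] that(2) by auto
  have "bij_betw ?\<gamma> (SIGMA k:verts H. {..<card (f k)}) (verts X)"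
  proof (rule bij_betw_imageI)
    show "inj_on ?\<gamma> (SIGMA k:verts H. {..<card (f k)})"
    proof (rule inj_onI, clarsimp)
      fix k l k' l'
      assume *: "k \<in> verts H" "k' \<in> verts H" "l < card (f k)" "l' < card (f k')" "g k l = g k' l'"
      then have "k = k'"
        using gq by metis
      with * g[of k] show "k = k' \<and> l = l'"
        by (auto simp: bij_betw_def inj_on_def)
    qed
    show "?\<gamma> ` (SIGMA k:verts H. {..<card (f k)}) = verts X"
    proof
      show "verts X \<subseteq> ?\<gamma> ` (SIGMA k:verts H. {..<card (f k)})"
      proof
        fix u assume u: "u \<in> verts X"
        then have "u \<in> f (q u)"
          using fq q by auto
        then obtain l where "l < card (f (q u))" "u = g (q u) l"
          using g[OF q[OF u]] by (auto simp: bij_betw_def)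
        then show "u \<in> ?\<gamma> ` (SIGMA k:verts H. {..<card (f k)})"
          using q[OF u] by force
      qed
    qed (use gq in auto)
  qed
  from bij_betw_trans[OF \<beta> this] have b: "bij_betw (?\<gamma> \<circ> \<beta>) (medges Z) (verts X)" .
  let ?h = "?\<gamma> \<circ> \<beta>"
  have h: "?h j \<in> verts X" "q (?h j) = fst (\<beta> j)" if "j \<in> medges Z" for j
  proof -
    have "\<beta> j \<in> (SIGMA k:verts H. {..<card (f k)})"
      using bij_betw_apply[OF \<beta> that] .
    then show "?h j \<in> verts X" "q (?h j) = fst (\<beta> j)"
      using gq by (cases "\<beta> j"; auto)+
  qed
  have "{i, j} \<in> edges (line_graph_of_multigraph Z) \<longleftrightarrow> {?h i, ?h j} \<in> edges X"
    if ij: "i \<in> medges Z" "j \<in> medges Z" for i j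
  proof (cases "i = j")
    case True
    have "?h i \<in> verts X" using h ij by blast
    moreover have "{u} \<notin> edges X" if "u \<in> verts X" for u
      using X by (auto simp: simple_graph_def)
    ultimately show ?thesis
      using True line_graph_of_multigraph_edge_iff[of i i Z] by simp
  next
    case False
    then have ne: "?h i \<noteq> ?h j"
      using b ij by (meson bij_betw_imp_inj_on inj_on_contraD)
    have "ends Z i \<inter> ends Z j \<noteq> {} \<longleftrightarrow> fst (\<beta> i) = fst (\<beta> j) \<or> {fst (\<beta> i), fst (\<beta> j)} \<in> edges H"
    proof (cases "fst (\<beta> i) = fst (\<beta> j)")
      case True
      have "r (fst (\<beta> i)) \<noteq> {}"
        using r2(2)[OF \<beta>H[OF ij(1)]] by auto
      then show ?thesis
        using True ends ij by simp
    next
      case False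
      then have "r (fst (\<beta> i)) \<noteq> r (fst (\<beta> j))"
        using r \<beta>H ij by (meson bij_betw_imp_inj_on graph_iso_def inj_on_contraD)
      moreover have "{fst (\<beta> i), fst (\<beta> j)} \<in> edges H \<longleftrightarrow>
          {r (fst (\<beta> i)), r (fst (\<beta> j))} \<in> edges (line_graph Y)"
        using r \<beta>H[OF ij(1)] \<beta>H[OF ij(2)] unfolding graph_iso_def by blast
      ultimately show ?thesis
        using False ends[OF ij(1)] ends[OF ij(2)] rE[OF \<beta>H[OF ij(1)]] rE[OF \<beta>H[OF ij(2)]]
        by (simp add: line_graph_edge_iff)
    qed
    then show ?thesis
      using edge[OF h(1)[OF ij(1)] h(1)[OF ij(2)] ne] h(2) ij False
      unfolding line_graph_of_multigraph_edge_iff by simp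
  qed
  then have "graph_iso ?h (line_graph_of_multigraph Z) X"
    using b by (simp add: graph_iso_def line_graph_of_multigraph_def)
  with \<open>multigraph Z\<close> show ?thesis
    unfolding isomorphic_def by blast
qed

lemma is_line_multigraph_iso:
  assumes "isomorphic X Y"
  shows "is_line_multigraph X \<longleftrightarrow> is_line_multigraph Y"
  using assms isomorphic_trans isomorphic_sym unfolding is_line_multigraph_def by metis

text \<open>Parallel edges are true twins of the line graph, so representatives of the twin classes
  form a root without parallel edges.\<close>

lemma line_multigraph_contraction:
  fixes H :: "'a graph"
  assumes X: "is_line_multigraph X" and f: "graph_iso f H (contraction X)"
  shows "is_line_graph H"
proof -
  obtain Y :: "(nat, nat) multigraph" and g
    where Y: "multigraph Y" and g: "graph_iso g (line_graph_of_multigraph Y) X"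
    using X by (auto simp: is_line_multigraph_def isomorphic_def)
  obtain q where q: "\<And>u. u \<in> verts X \<Longrightarrow> q u \<in> verts H"
    and fq: "\<And>k. k \<in> verts H \<Longrightarrow> f k = {u \<in> verts X. q u = k}"
    and nonempty: "\<And>k. k \<in> verts H \<Longrightarrow> f k \<noteq> {}"
    and edge: "\<And>u v. u \<in> verts X \<Longrightarrow> v \<in> verts X \<Longrightarrow> u \<noteq> v \<Longrightarrow>
       {u, v} \<in> edges X \<longleftrightarrow> q u = q v \<or> {q u, q v} \<in> edges H"
    and twins: "\<And>u v. u \<in> verts X \<Longrightarrow> v \<in> verts X \<Longrightarrow> closed_nbhd X u = closed_nbhd X v \<Longrightarrow> q u = q v"
    and loops: "\<And>k. k \<in> verts H \<Longrightarrow> {k} \<notin> edges H"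
    by (rule contraction_iso_quotient[OF f]) (rule that)
  have b: "bij_betw g (medges Y) (verts X)"
    using g by (simp add: graph_iso_def line_graph_of_multigraph_def)
  have gedge: "{g e, g e'} \<in> edges X \<longleftrightarrow> e \<noteq> e' \<and> ends Y e \<inter> ends Y e' \<noteq> {}"
    if "e \<in> medges Y" "e' \<in> medges Y" for e e'
    using g that line_graph_of_multigraph_edge_iff[of e e' Y]
    by (simp add: graph_iso_def line_graph_of_multigraph_def)
  have "\<exists>e. e \<in> medges Y \<and> q (g e) = k" if k: "k \<in> verts H" for k
  proof -
    obtain u where "u \<in> verts X" "q u = k"
      using fq[OF k] nonempty[OF k] by auto
    then show ?thesis
      using b by (metis bij_betw_def imageE)
  qed
  then obtain e where e: "\<And>k. k \<in> verts H \<Longrightarrow> e k \<in> medges Y" "\<And>k. k \<in> verts H \<Longrightarrow> q (g (e k)) = k"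
    by metis
  have gX: "g i \<in> verts X" if "i \<in> medges Y" for i
    using b that by (auto simp: bij_betw_def)
  have gsurj: "\<exists>j\<in>medges Y. w = g j" if "w \<in> verts X" for w
    using b that by (auto simp: bij_betw_def)
  have ends: "ends Y i \<subseteq> mverts Y" "card (ends Y i) = 2" if "i \<in> medges Y" for i
    using Y that by (auto simp: multigraph_def)
  have inj: "k = k'" if k: "k \<in> verts H" "k' \<in> verts H" and eq: "ends Y (e k) = ends Y (e k')" for k k'
  proof -
    \<comment> \<open>The edges meeting \<open>ends Y i\<close> include \<open>i\<close> itself,
      since its ends are nonempty. So the closed neighbourhood depends on the ends alone.\<close>
    have nb: "closed_nbhd X (g i) = g ` {j \<in> medges Y. ends Y i \<inter> ends Y j \<noteq> {}}"
      if i: "i \<in> medges Y" for i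
    proof -
      have "ends Y i \<noteq> {}"
        using ends(2)[OF i] by auto
      then have *: "g j \<in> closed_nbhd X (g i) \<longleftrightarrow> ends Y i \<inter> ends Y j \<noteq> {}"
        if j: "j \<in> medges Y" for j
        using closed_nbhd_iff[OF gX[OF j], of "g i"] gedge[OF i j] b i j
        by (auto dest: bij_betw_imp_inj_on inj_onD)
      have "closed_nbhd X (g i) \<subseteq> g ` medges Y"
        using b i by (auto simp: closed_nbhd_def bij_betw_def)
      then show ?thesis
        using * by (auto simp: subset_iff image_iff) metis
    qed
    have "closed_nbhd X (g (e k)) = closed_nbhd X (g (e k'))"
      by (simp only: nb[OF e(1)[OF k(1)]] nb[OF e(1)[OF k(2)]] eq)
    then show ?thesis
      using twins gX e k by metis
  qed
  \<comment> \<open>One edge per class. Twins that are not parallel are dropped as well, which is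
    harmless because adjacency between different classes can be read off any members.\<close>
  define R where "R = \<lparr>verts = mverts Y, edges = (\<lambda>k. ends Y (e k)) ` verts H\<rparr>"
  have "simple_graph R"
    using Y ends e(1) by (auto simp: simple_graph_def R_def multigraph_def)
  have "graph_iso (\<lambda>k. ends Y (e k)) H (line_graph R)"
    unfolding graph_iso_def
  proof (intro conjI ballI)
    show "bij_betw (\<lambda>k. ends Y (e k)) (verts H) (verts (line_graph R))"
      using inj by (auto simp: bij_betw_def inj_on_def line_graph_def R_def)
    fix k l assume kl: "k \<in> verts H" "l \<in> verts H"
    show "{k, l} \<in> edges H \<longleftrightarrow> {ends Y (e k), ends Y (e l)} \<in> edges (line_graph R)"
    proof (cases "k = l")
      case True
      then show ?thesis
        using loops kl line_graph_edge_iff[of "ends Y (e k)" "ends Y (e k)" R] by auto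
    next
      case False
      have ne: "e k \<noteq> e l" "g (e k) \<noteq> g (e l)"
        using e kl False by metis+
      have "{k, l} \<in> edges H \<longleftrightarrow> {g (e k), g (e l)} \<in> edges X"
        using edge[OF gX[OF e(1)[OF kl(1)]] gX[OF e(1)[OF kl(2)]] ne(2)] e kl False by simp
      also have "\<dots> \<longleftrightarrow> {ends Y (e k), ends Y (e l)} \<in> edges (line_graph R)"
        using gedge[OF e(1)[OF kl(1)] e(1)[OF kl(2)]] ne inj kl False
        by (auto simp: line_graph_edge_iff R_def)
      finally show ?thesis .
    qed
  qed
  then have "isomorphic (line_graph R) H"
    using graph_iso_inv unfolding isomorphic_def by blast
  with \<open>simple_graph R\<close> show ?thesis
    unfolding is_line_graph_def by blast
qed


section \<open>Building blocks of the programs\<close>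

abbreviation V :: "vname \<Rightarrow> aexp" where
  "V x \<equiv> Cell x (N 0)"

lemma matrix_index_eq_iff:
  fixes n :: nat
  assumes "j < n" and "j' < n"
  shows "i * n + j = i' * n + j' \<longleftrightarrow> i = i' \<and> j = j'"
proof
  assume *: "i * n + j = i' * n + j'"
  have "i = (i * n + j) div n" "i' = (i' * n + j') div n" "j = (i * n + j) mod n" "j' = (i' * n + j') mod n"
    using assms by auto
  with * show "i = i' \<and> j = j'" by metis
qed simp

text \<open>First ends sit in even slots and second ends in odd ones, so writing edge
  \<open>e\<close> changes no other edge. The form \<open>e + e\<close> is what a machine without
  multiplication computes.\<close>

lemma edge_at_upd_eq:
  "edge_at (a(2 + (e + e) := u, 3 + (e + e) := v)) = (edge_at a)(e := {u, v})"
proof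
  fix k
  have "3 + 2 * k \<noteq> 2 + (e + e)" "2 + 2 * k \<noteq> 3 + (e + e)"
    by presburger+
  then show "edge_at (a(2 + (e + e) := u, 3 + (e + e) := v)) k = ((edge_at a)(e := {u, v})) k"
    by (simp add: edge_at_def)
qed

text \<open>Allows the header to be written after the edges, when their number is known.\<close>

lemma edge_at_header_upd [simp]:
  "edge_at (a(0 := x)) = edge_at a" "edge_at (a(Suc 0 := x)) = edge_at a"
  by (auto simp: edge_at_def)

lemma image_fun_upd_lessThan_Suc: "(f(n := y)) ` {..<Suc n} = insert y (f ` {..<n})"
  by (auto simp: lessThan_Suc)

lemma inj_on_fun_upd_lessThan_Suc:
  "inj_on (f(n := y)) {..<Suc n} \<longleftrightarrow> inj_on f {..<n} \<and> y \<notin> f ` {..<n}"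
proof -
  have "inj_on (f(n := y)) {..<n} \<longleftrightarrow> inj_on f {..<n}"
    by (rule inj_on_cong) simp
  moreover have "(f(n := y)) ` {..<n} = f ` {..<n}"
    by (rule image_cong) auto
  ultimately show ?thesis
    by (simp add: lessThan_Suc)
qed

text \<open>The machine cannot multiply, so the addresses of the rows of a matrix are tabulated.\<close>

definition row_table :: "aexp \<Rightarrow> com" where
  "row_table b = Assign ''R'' (N 0) (N 0) ;;
     For ''i'' b (Assign ''R'' (Plus (V ''i'') (N 1)) (Plus (Cell ''R'' (V ''i'')) b))"

lemma writes_row_table [simp]: "writes (row_table b) = {''R'', ''i''}"
  by (auto simp: row_table_def)

lemma runs_row_table:
  assumes B: "n < B" and b: "\<And>s'. agree {''R'', ''i''} s s' \<Longrightarrow> aval b s' = n"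
  shows "runs B 1 (row_table b) s (\<lambda>s'. \<forall>i\<le>n. s' ''R'' i = i * n)"
  unfolding row_table_def
proof (rule runs_Seq[where R = "\<lambda>s'. s' ''R'' 0 = 0"])
  show "runs B 1 (Assign ''R'' (N 0) (N 0)) s (\<lambda>s'. s' ''R'' 0 = 0)"
    by (rule runs_loop_free) (use B in simp_all)
  fix s1 :: state
  assume s1: "s1 ''R'' 0 = 0" and ag: "agree (writes (Assign ''R'' (N 0) (N 0))) s s1"
  let ?c = "Assign ''R'' (Plus (V ''i'') (N 1)) (Plus (Cell ''R'' (V ''i'')) b)"
  have b': "aval b s' = n" if "agree (insert ''i'' (writes ?c)) s1 s'" for s'
    by (rule b, rule agree_trans[OF ag that]) simp
  have "runs B (0 + 1) (For ''i'' b ?c) s1 (\<lambda>s'. \<forall>i\<le>n. s' ''R'' i = i * n)"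
  proof (rule runs_For[where I = "\<lambda>k s'. \<forall>i\<le>k. s' ''R'' i = i * n"])
    fix i s'
    assume i: "i < n" "s' ''i'' 0 = i" "agree (insert ''i'' (writes ?c)) s1 s'"
      and I: "\<forall>k\<le>i. s' ''R'' k = k * n"
    show "runs B 0 ?c s' (\<lambda>s'. \<forall>k\<le>Suc i. s' ''R'' k = k * n)"
      by (rule runs_loop_free) (use B i I b' in \<open>auto simp: le_Suc_eq\<close>)
  qed (use B b' s1 in auto)
  then show "runs B 1 (For ''i'' b ?c) s1 (\<lambda>s'. \<forall>i\<le>n. s' ''R'' i = i * n)"
    by simp
qed

section \<open>Listing the edges of a graph from a test on pairs\<close>

definition append_edge :: "vname \<Rightarrow> aexp \<Rightarrow> aexp \<Rightarrow> com" where
  "append_edge x a b = Assign x (Plus (N 2) (Plus (V ''e'') (V ''e''))) a ;;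
     Assign x (Plus (N 3) (Plus (V ''e'') (V ''e''))) b ;;
     Assign ''e'' (N 0) (Plus (V ''e'') (N 1))"

text \<open>With \<open>j < i\<close> each unordered pair is tested once, so neither loops nor
  repeated edges can arise.\<close>

definition emit_graph :: "vname \<Rightarrow> aexp \<Rightarrow> bexp \<Rightarrow> com" where
  "emit_graph x b t =
     Assign ''e'' (N 0) (N 0) ;;
     For ''i'' b (For ''j'' (V ''i'') (If t (append_edge x (V ''i'') (V ''j'')) SKIP)) ;;
     Assign x (N 0) b ;; Assign x (N 1) (V ''e'')"

lemma writes_append_edge [simp]: "writes (append_edge x a b) = {x, ''e''}"
  by (auto simp: append_edge_def)

text \<open>The second end is evaluated after the first has been written into \<open>x\<close>,
  hence the assumption on \<open>b\<close> for every content of \<open>x\<close>.\<close>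

lemma result_append_edge:
  assumes "x \<noteq> ''e''" and a: "aval a s = u" and b: "\<And>f. aval b (s(x := f)) = v"
  shows "result (append_edge x a b) s ''e'' 0 = Suc (s ''e'' 0)"
    and "edge_at (result (append_edge x a b) s x) = (edge_at (s x))(s ''e'' 0 := {u, v})"
proof -
  have "result (append_edge x a b) s x =
      (s x)(2 + (s ''e'' 0 + s ''e'' 0) := u, 3 + (s ''e'' 0 + s ''e'' 0) := v)"
    using assms by (simp add: append_edge_def)
  then show "edge_at (result (append_edge x a b) s x) = (edge_at (s x))(s ''e'' 0 := {u, v})"
    by (simp only: edge_at_upd_eq)
  show "result (append_edge x a b) s ''e'' 0 = Suc (s ''e'' 0)"
    using assms by (simp add: append_edge_def)
qed

lemma writes_emit_graph [simp]: "writes (emit_graph x b t) = {x, ''e'', ''i'', ''j''}"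
  by (auto simp: emit_graph_def)

lemma runs_emit_graph:
  assumes B: "n < B" and x: "x \<notin> {''e'', ''i'', ''j''}"
    and b: "\<And>s'. agree {x, ''e'', ''i'', ''j''} s s' \<Longrightarrow> aval b s' = n"
    and t: "\<And>s'. \<lbrakk>agree {x, ''e'', ''i'', ''j''} s s'; s' ''i'' 0 < n; s' ''j'' 0 < s' ''i'' 0\<rbrakk>
      \<Longrightarrow> bval t s' \<longleftrightarrow> P (s' ''i'' 0) (s' ''j'' 0)"
  shows "runs B 2 (emit_graph x b t) s (\<lambda>s'. holds_simple_graph (s' x) \<and>
    graph_of (s' x) = \<lparr>verts = {..<n}, edges = {{i, j} | i j. i < n \<and> j < i \<and> P i j}\<rparr>)"
proof -
  \<comment> \<open>The edges found before position \<open>(k, l)\<close> in the lexicographic order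
    of the two loops.\<close>
  define S where "S k l = {{i, j} | i j. j < i \<and> P i j \<and> (i < k \<or> i = k \<and> j < l)}" for k l
  define I where "I k l s' \<longleftrightarrow> inj_on (edge_at (s' x)) {..<s' ''e'' 0} \<and>
    edge_at (s' x) ` {..<s' ''e'' 0} = S k l" for k l and s' :: state
  let ?c = "If t (append_edge x (V ''i'') (V ''j'')) SKIP"
  let ?W = "{x, ''e'', ''i'', ''j''}"
  have x': "x \<noteq> ''e''" "x \<noteq> ''i''" "x \<noteq> ''j''" "''e'' \<noteq> x" "''i'' \<noteq> x" "''j'' \<noteq> x"
    using x by auto
  have w: "insert ''i'' (insert ''j'' (writes ?c)) = ?W"
    by auto
  show ?thesis
    unfolding emit_graph_def
  proof (rule runs_Seq[where R = "I 0 0"], goal_cases)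
    case 1
    show ?case
      by (rule runs_loop_free) (use B in \<open>auto simp: I_def S_def\<close>)
  next
    case (2 s1)
    then have ag: "agree ?W s s1"
      by (simp add: agree_def)
    show ?case
    proof (rule runs_Seq[where R = "I n 0"], goal_cases)
      case 1
      have "runs B (0 + 2) (For ''i'' b (For ''j'' (V ''i'') ?c)) s1 (I n 0)"
      proof (rule runs_For2[where m = "\<lambda>i. i"], goal_cases)
        case (6 s')
        then show ?case
          by (intro b agree_trans[OF ag]) (auto simp: w)
      next
        case (11 i j s')
        have ag': "agree ?W s s'"
          by (rule agree_trans[OF ag 11(5)[unfolded w]]) simp
        have t': "bval t s' \<longleftrightarrow> P i j"
          using t[OF ag'] 11 by simp
        have I: "inj_on (edge_at (s' x)) {..<s' ''e'' 0}" "edge_at (s' x) ` {..<s' ''e'' 0} = S i j"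
          using 11(6) by (auto simp: I_def)
        \<comment> \<open>As \<open>j < i\<close>, the set \<open>{i, j}\<close> determines the
          pair, and this pair has not been visited yet.\<close>
        have new: "{i, j} \<notin> S i j"
          by (auto simp: S_def doubleton_eq_iff)
        have S: "S i (Suc j) = (if P i j then insert {i, j} (S i j) else S i j)"
          using 11(2) by (auto simp: S_def less_Suc_eq)
        show ?case
        proof (rule runs_If)
          assume "bval t s'"
          show "runs B 0 (append_edge x (V ''i'') (V ''j'')) s' (I i (Suc j))"
          proof (rule runs_loop_free)
            have a: "aval (V ''i'') s' = i" and b: "aval (V ''j'') (s'(x := f)) = j" for f
              using 11(3,4) x' by simp_all
            show "I i (Suc j) (result (append_edge x (V ''i'') (V ''j'')) s')"
              using \<open>bval t s'\<close> t' S I new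
              unfolding I_def result_append_edge[OF x'(1) a b]
                inj_on_fun_upd_lessThan_Suc image_fun_upd_lessThan_Suc by simp
          qed (use B in \<open>simp_all add: append_edge_def\<close>)
        next
          assume "\<not> bval t s'"
          then show "runs B 0 SKIP s' (I i (Suc j))"
            using 11(6) t' S B by (intro runs_loop_free) (simp_all add: I_def)
        qed (use B in simp)
      next
        case (12 i s')
        have "S i i = S (Suc i) 0"
          by (auto simp: S_def less_Suc_eq)
        then show ?case
          using 12 by (simp add: I_def)
      qed (use B x x' 2 in \<open>auto simp: I_def\<close>)
      then show ?case
        by (simp only: add_0)
    next
      case (2 s2)
      then have "agree ?W s1 s2"
        by (simp add: insert_commute)
      then have ag2: "agree ?W s s2"
        using agree_trans[OF ag] by simp
      have bn: "aval b s2 = n"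
        by (rule b[OF ag2])
      have S: "{{i, j} | i j. i < n \<and> j < i \<and> P i j} = S n 0"
        by (auto simp: S_def)
      show ?case
      proof (rule runs_loop_free)
        define r where "r = result (Assign x (N 0) b ;; Assign x (N 1) (V ''e'')) s2"
        have r: "r x 0 = n" "r x 1 = s2 ''e'' 0" "edge_at (r x) = edge_at (s2 x)"
          using bn x' by (simp_all add: r_def)
        have I: "inj_on (edge_at (s2 x)) {..<s2 ''e'' 0}" "edge_at (s2 x) ` {..<s2 ''e'' 0} = S n 0"
          using 2(1) by (simp_all add: I_def)
        have g: "graph_of (r x) = \<lparr>verts = {..<n}, edges = {{i, j} | i j. i < n \<and> j < i \<and> P i j}\<rparr>"
          unfolding S graph_of_def r I ..
        have "simple_graph (graph_of (r x))"
          unfolding g by (auto simp: simple_graph_def)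
        then have "holds_simple_graph (r x)"
          using I(1) unfolding holds_simple_graph_def r by blast
        with g show "holds_simple_graph (result (Assign x (N 0) b ;; Assign x (N 1) (V ''e'')) s2 x) \<and>
            graph_of (result (Assign x (N 0) b ;; Assign x (N 1) (V ''e'')) s2 x) =
              \<lparr>verts = {..<n}, edges = {{i, j} | i j. i < n \<and> j < i \<and> P i j}\<rparr>"
          unfolding r_def by blast
      qed (use B in simp_all)
    qed
  qed
qed

section \<open>Filling a square matrix\<close>

definition fill_matrix :: "aexp \<Rightarrow> com \<Rightarrow> com" where
  "fill_matrix b c = For ''i'' b (For ''j'' b c)"

lemma writes_fill_matrix [simp]: "writes (fill_matrix b c) = {''i'', ''j''} \<union> writes c"
  by (auto simp: fill_matrix_def)

lemma runs_fill_matrix: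
  assumes B: "n < B" and x: "x \<notin> {''i'', ''j''}" and c: "writes c = {x}"
    and b: "\<And>s'. agree {x, ''i'', ''j''} s s' \<Longrightarrow> aval b s' = n"
    and body: "\<And>i j s'. \<lbrakk>i < n; j < n; s' ''i'' 0 = i; s' ''j'' 0 = j; agree {x, ''i'', ''j''} s s'\<rbrakk>
      \<Longrightarrow> runs B 0 c s' (\<lambda>s''. s'' x = (s' x)(i * n + j := F i j))"
  shows "runs B 2 (fill_matrix b c) s (\<lambda>s'. \<forall>i<n. \<forall>j<n. s' x (i * n + j) = F i j)"
proof -
  define I where "I i j s' \<longleftrightarrow>
    (\<forall>i'<n. \<forall>j'<n. i' < i \<or> i' = i \<and> j' < j \<longrightarrow> s' x (i' * n + j') = F i' j')" for i j and s' :: state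
  have w: "insert ''i'' (insert ''j'' (writes c)) = {x, ''i'', ''j''}"
    using c by auto
  have x': "x \<noteq> ''i''" "x \<noteq> ''j''"
    using x by auto
  have "runs B (0 + 2) (For ''i'' b (For ''j'' b c)) s (I n 0)"
  proof (rule runs_For2[where m = "\<lambda>i. n"], goal_cases)
    case (11 i j s')
    show ?case
    proof (rule runs_conseq[OF body[OF 11(1-4) 11(5)[unfolded w]]])
      fix s''
      assume s'': "s'' x = (s' x)(i * n + j := F i j)"
      have "s'' x (i' * n + j') = F i' j'"
        if "i' < n" "j' < n" "i' < i \<or> i' = i \<and> j' < Suc j" for i' j'
        using that 11(6) matrix_index_eq_iff[OF that(2) 11(2), of i' i] unfolding s'' I_def
        by (auto simp: less_Suc_eq)
      then show "I i (Suc j) s''"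
        by (simp add: I_def)
    qed
  qed (use B x' c b w in \<open>auto simp: I_def less_Suc_eq\<close>)
  then have "runs B 2 (fill_matrix b c) s (I n 0)"
    unfolding fill_matrix_def by (simp only: add_0)
  then show ?thesis
    by (rule runs_conseq) (simp add: I_def)
qed


section \<open>Constructing the conflict graph\<close>

text \<open>Walks of length \<open>l\<close> from \<open>i\<close> to \<open>j\<close> whose inner
  vertices lie in \<open>K\<close>, the quantity of the Floyd-Warshall recursion. The rule
  \<open>edge\<close> is separate because end points may lie outside \<open>K\<close>;
  \<open>step\<close> turns the old end point into an inner vertex.\<close>

inductive through :: "('a \<times> 'a) set \<Rightarrow> 'a set \<Rightarrow> 'a \<Rightarrow> 'a \<Rightarrow> nat \<Rightarrow> bool" for E K where
  refl: "through E K i i 0"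
| edge: "(i, j) \<in> E \<Longrightarrow> through E K i j (Suc 0)"
| step: "through E K i h l \<Longrightarrow> h \<in> K \<Longrightarrow> (h, j) \<in> E \<Longrightarrow> through E K i j (Suc l)"

text \<open>Cut at the first and at the last visit of \<open>k\<close> and drop what lies between;
  this is why only \<open>a + b \<le> l\<close> holds.\<close>

lemma through_insert:
  assumes "through E (insert k K) i j l"
  shows "through E K i j l \<or> (\<exists>a b. through E K i k a \<and> through E K k j b \<and> a + b \<le> l)"
  using assms
proof induction
  case (step i h l j)
  consider "h = k" | "h \<in> K"
    using step.hyps by blast
  then show ?case
  proof cases
    case 1
    \<comment> \<open>The last edge leaves \<open>k\<close>, so it alone is the second piece; of the
      earlier walk only its first piece up to \<open>k\<close> is kept.\<close>
    have kj: "through E K k j (Suc 0)"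
      using step.hyps 1 by (auto intro: through.edge)
    from step.IH show ?thesis
    proof (elim disjE exE conjE)
      assume "through E K i h l"
      with kj show ?thesis
        unfolding 1 by (intro disjI2 exI[of _ l] exI[of _ "Suc 0"]) simp
    next
      fix a b
      assume "through E K i k a" "a + b \<le> l"
      with kj show ?thesis
        by (intro disjI2 exI[of _ a] exI[of _ "Suc 0"]) simp
    qed
  next
    case 2
    from step.IH show ?thesis
    proof (elim disjE exE conjE)
      assume "through E K i h l"
      with 2 step.hyps show ?thesis
        by (blast intro: through.step)
    next
      fix a b
      assume ab: "through E K i k a" "through E K k h b" "a + b \<le> l"
      then have "through E K k j (Suc b)"
        using 2 step.hyps by (blast intro: through.step)
      with ab show ?thesis
        by (intro disjI2 exI[of _ a] exI[of _ "Suc b"]) simp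
    qed
  qed
qed (auto intro: through.refl through.edge)

lemma relpow_imp_through:
  assumes "E \<subseteq> K \<times> K" and "(i, j) \<in> E ^^ l"
  shows "through E K i j l"
  using assms(2)
proof (induction l arbitrary: j)
  case 0
  then show ?case by (simp add: through.refl)
next
  case (Suc l)
  then obtain h where "(i, h) \<in> E ^^ l" "(h, j) \<in> E" by auto
  with Suc.IH assms(1) show ?case
    by (blast intro: through.step)
qed

text \<open>One half of the specification of a distance matrix, truncated at \<open>M\<close>:
  entries above \<open>M\<close> carry no information, so \<open>M + 1\<close> can stand for
  infinity in ordinary arithmetic.\<close>

definition sound_dist :: "(nat \<times> nat) set \<Rightarrow> nat \<Rightarrow> nat \<Rightarrow> (nat \<Rightarrow> nat) \<Rightarrow> bool" where
  "sound_dist E M n D \<longleftrightarrow> (\<forall>i<n. \<forall>j<n. D (i * n + j) \<le> M \<longrightarrow> (i, j) \<in> E ^^ D (i * n + j))"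

text \<open>The other half. It is only an inequality, since updates in place may already have used
  inner vertices outside \<open>K\<close>.\<close>

definition dist_le_through :: "(nat \<times> nat) set \<Rightarrow> nat set \<Rightarrow> nat \<Rightarrow> (nat \<Rightarrow> nat) \<Rightarrow> nat \<Rightarrow> nat \<Rightarrow> bool" where
  "dist_le_through E K n D i j \<longleftrightarrow> (\<forall>l. through E K i j l \<longrightarrow> D (i * n + j) \<le> l)"

definition relaxed :: "nat \<Rightarrow> nat \<Rightarrow> nat \<Rightarrow> nat \<Rightarrow> (nat \<Rightarrow> nat) \<Rightarrow> nat \<Rightarrow> nat" where
  "relaxed n k i j D = D(i * n + j := min (D (i * n + j)) (D (i * n + k) + D (k * n + j)))"

lemma relaxed_le: "relaxed n k i j D x \<le> D x"
  by (simp add: relaxed_def)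

lemma dist_le_through_relaxed:
  "dist_le_through E K n D i' j' \<Longrightarrow> dist_le_through E K n (relaxed n k i j D) i' j'"
  unfolding dist_le_through_def by (meson le_trans relaxed_le)

text \<open>If a sum is at most \<open>M\<close>, so are both summands. Both are then lengths of
  genuine walks, which \<open>relpow_add\<close> concatenates.\<close>

lemma sound_dist_relaxed:
  assumes sound: "sound_dist E M n D" and "k < n" "i < n" "j < n"
  shows "sound_dist E M n (relaxed n k i j D)"
  unfolding sound_dist_def
proof (intro allI impI)
  fix i' j'
  assume ij: "i' < n" "j' < n" and le: "relaxed n k i j D (i' * n + j') \<le> M"
  show "(i', j') \<in> E ^^ relaxed n k i j D (i' * n + j')"
  proof (cases "i' = i \<and> j' = j \<and> D (i * n + k) + D (k * n + j) < D (i * n + j)")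
    case True
    then have eq: "relaxed n k i j D (i' * n + j') = D (i * n + k) + D (k * n + j)"
      by (simp add: relaxed_def)
    then have "(i, k) \<in> E ^^ D (i * n + k)" "(k, j) \<in> E ^^ D (k * n + j)"
      using sound le assms by (auto simp: sound_dist_def)
    with True eq show ?thesis
      by (auto simp: relpow_add)
  next
    case False
    then have "relaxed n k i j D (i' * n + j') = D (i' * n + j')"
      using matrix_index_eq_iff[OF ij(2) assms(4), of i' i] by (auto simp: relaxed_def)
    with sound le ij show ?thesis
      by (simp add: sound_dist_def)
  qed
qed

text \<open>This is \<open>through_insert\<close> in terms of entries. Only the bounds for
  \<open>K\<close> are required of the three entries read, never those for
  \<open>insert k K\<close>.\<close>

lemma dist_le_through_relaxed_insert:
  assumes "dist_le_through E K n D i j" "dist_le_through E K n D i k" "dist_le_through E K n D k j"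
  shows "dist_le_through E (insert k K) n (relaxed n k i j D) i j"
  unfolding dist_le_through_def
proof (intro allI impI)
  fix l
  assume "through E (insert k K) i j l"
  from through_insert[OF this] show "relaxed n k i j D (i * n + j) \<le> l"
  proof (elim disjE exE conjE)
    assume "through E K i j l"
    then have "D (i * n + j) \<le> l"
      using assms(1) by (simp add: dist_le_through_def)
    then show ?thesis
      by (simp add: relaxed_def)
  next
    fix a b
    assume "through E K i k a" "through E K k j b" "a + b \<le> l"
    then have "D (i * n + k) + D (k * n + j) \<le> l"
      using assms(2,3) unfolding dist_le_through_def by (meson add_mono le_trans)
    then show ?thesis
      by (simp add: relaxed_def)
  qed
qed

section \<open>The Floyd-Warshall program\<close>

abbreviation entry :: "vname \<Rightarrow> aexp \<Rightarrow> aexp \<Rightarrow> aexp" where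
  "entry x i j \<equiv> Cell x (Plus (Cell ''R'' i) j)"

definition relax :: com where
  "relax = If (Less (Plus (entry ''D'' (V ''i'') (V ''k'')) (entry ''D'' (V ''k'') (V ''j''))) (entry ''D'' (V ''i'') (V ''j'')))
     (Assign ''D'' (Plus (Cell ''R'' (V ''i'')) (V ''j''))
       (Plus (entry ''D'' (V ''i'') (V ''k'')) (entry ''D'' (V ''k'') (V ''j'')))) SKIP"

definition floyd_warshall :: "aexp \<Rightarrow> com" where
  "floyd_warshall b = For ''k'' b (For ''i'' b (For ''j'' b relax))"

lemma writes_relax [simp]: "writes relax = {''D''}"
  by (simp add: relax_def)

lemma writes_floyd_warshall [simp]: "writes (floyd_warshall b) = {''k'', ''i'', ''j'', ''D''}"
  by (simp add: floyd_warshall_def)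

text \<open>Relaxing in place is harmless: entries only decrease and stay lengths of walks, so it does not
  matter whether row and column \<open>k\<close> are read before or after their own update.\<close>

lemma runs_floyd_warshall:
  assumes B: "n < B" and E: "E \<subseteq> {..<n} \<times> {..<n}"
    and b: "\<And>s'. agree {''k'', ''i'', ''j'', ''D''} s s' \<Longrightarrow> aval b s' = n"
    and R: "\<forall>i\<le>n. s ''R'' i = i * n"
    and sound: "sound_dist E M n (s ''D'')"
    and init: "\<And>i j. i < n \<Longrightarrow> j < n \<Longrightarrow> dist_le_through E {} n (s ''D'') i j"
  shows "runs B 3 (floyd_warshall b) s (\<lambda>s'. \<forall>i<n. \<forall>j<n.
    s' ''D'' (i * n + j) \<le> M \<longleftrightarrow> (\<exists>l\<le>M. (i, j) \<in> E ^^ l))"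
proof -
  let ?W = "{''k'', ''i'', ''j'', ''D''}"
  define I where "I k s' \<longleftrightarrow> sound_dist E M n (s' ''D'') \<and>
    (\<forall>i<n. \<forall>j<n. dist_le_through E {..<k} n (s' ''D'') i j)" for k and s' :: state
  \<comment> \<open>Within round \<open>k\<close> every entry keeps its bound for inner vertices
    below \<open>k\<close>, and the entries already visited have the bound that also admits
    \<open>k\<close>.\<close>
  define J where "J k i j s' \<longleftrightarrow> I k s' \<and> (\<forall>i'<n. \<forall>j'<n. i' < i \<or> i' = i \<and> j' < j \<longrightarrow>
      dist_le_through E {..<Suc k} n (s' ''D'') i' j')" for k i j and s' :: state
  have "runs B (2 + 1) (floyd_warshall b) s (I n)"
    unfolding floyd_warshall_def
  proof (rule runs_For, goal_cases)
    case (7 k s')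
    have agk: "agree ?W s s'"
      using 7(3) by simp
    have "runs B (0 + 2) (For ''i'' b (For ''j'' b relax)) s' (J k n 0)"
    proof (rule runs_For2[where m = "\<lambda>_. n"], goal_cases)
      case (6 s'')
      show ?case
        by (rule b, rule agree_trans[OF agk 6]) simp
    next
      case (7 i s'')
      show ?case
        by (rule b, rule agree_trans[OF agk 7(3)]) simp
    next
      case (11 i j s'')
      have ag: "agree ?W s s''"
        by (rule agree_trans[OF agk 11(5)]) simp
      have k: "s'' ''k'' 0 = k"
        using 11(5) \<open>s' ''k'' 0 = k\<close> by (simp add: agree_def)
      have R': "s'' ''R'' i = i * n" "s'' ''R'' k = k * n"
        using ag R 11 \<open>k < n\<close> by (simp_all add: agree_def)
      have D: "result relax s'' ''D'' = relaxed n k i j (s'' ''D'')"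
        using k R' 11(3,4) by (simp add: relax_def relaxed_def fun_eq_iff min_def)
      have IJ: "sound_dist E M n (s'' ''D'')"
          "\<And>i j. i < n \<Longrightarrow> j < n \<Longrightarrow> dist_le_through E {..<k} n (s'' ''D'') i j"
          "\<And>i' j'. i' < n \<Longrightarrow> j' < n \<Longrightarrow> i' < i \<or> i' = i \<and> j' < j \<Longrightarrow>
             dist_le_through E {..<Suc k} n (s'' ''D'') i' j'"
        using 11(6) unfolding J_def I_def by blast+
      have new: "dist_le_through E {..<Suc k} n (relaxed n k i j (s'' ''D'')) i j"
        using dist_le_through_relaxed_insert[of E "{..<k}" n "s'' ''D''" i j k] IJ(2) 11 \<open>k < n\<close>
        by (simp add: lessThan_Suc)
      show ?case
      proof (rule runs_loop_free)
        show "J k i (Suc j) (result relax s'')"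
          unfolding J_def I_def D
        proof (intro conjI allI impI)
          show "sound_dist E M n (relaxed n k i j (s'' ''D''))"
            using IJ(1) \<open>k < n\<close> 11(1,2) by (rule sound_dist_relaxed)
          show "dist_le_through E {..<k} n (relaxed n k i j (s'' ''D'')) i' j'"
            if "i' < n" "j' < n" for i' j'
            using IJ(2)[OF that] by (rule dist_le_through_relaxed)
          show "dist_le_through E {..<Suc k} n (relaxed n k i j (s'' ''D'')) i' j'"
            if "i' < n" "j' < n" "i' < i \<or> i' = i \<and> j' < Suc j" for i' j'
          proof (cases "i' = i \<and> j' = j")
            case True
            then show ?thesis using new by simp
          next
            case False
            with that have "i' < i \<or> i' = i \<and> j' < j" by auto
            from IJ(3)[OF that(1,2) this] show ?thesis by (rule dist_le_through_relaxed)
          qed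
        qed
      qed (use B in \<open>simp_all add: relax_def\<close>)
    qed (use B 7(4) in \<open>auto simp: J_def I_def less_Suc_eq\<close>)
    then have "runs B 2 (For ''i'' b (For ''j'' b relax)) s' (J k n 0)"
      by (simp only: add_0)
    then show ?case
      by (rule runs_conseq) (simp add: J_def I_def)
  qed (use B b sound init in \<open>auto simp: I_def\<close>)
  then have "runs B 3 (floyd_warshall b) s (I n)"
    by simp
  then show ?thesis
  proof (rule runs_conseq, intro allI impI)
    fix s' i j
    assume I: "I n s'" and ij: "i < n" "j < n"
    show "s' ''D'' (i * n + j) \<le> M \<longleftrightarrow> (\<exists>l\<le>M. (i, j) \<in> E ^^ l)"
    proof
      assume "s' ''D'' (i * n + j) \<le> M"
      with I ij show "\<exists>l\<le>M. (i, j) \<in> E ^^ l"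
        by (auto simp: I_def sound_dist_def)
    next
      assume "\<exists>l\<le>M. (i, j) \<in> E ^^ l"
      then obtain l where l: "l \<le> M" "(i, j) \<in> E ^^ l" by blast
      \<comment> \<open>After \<open>n\<close> rounds the restriction on inner vertices is vacuous,
        because \<open>E\<close> lives on \<open>{..<n}\<close>.\<close>
      have "s' ''D'' (i * n + j) \<le> l"
        using I ij relpow_imp_through[OF E l(2)] by (simp add: I_def dist_le_through_def)
      with l(1) show "s' ''D'' (i * n + j) \<le> M" by simp
    qed
  qed
qed

text \<open>A disjunction of four equalities, put into De Morgan form because the language has no
  disjunction.\<close>

definition share_end :: bexp where
  "share_end = (let a = (\<lambda>c x. Cell ''G'' (Plus (N c) (Plus (V x) (V x)))) in
     Not (And
       (And (Not (Eq (a 2 ''i'') (a 2 ''j''))) (Not (Eq (a 2 ''i'') (a 3 ''j''))))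
       (And (Not (Eq (a 3 ''i'') (a 2 ''j''))) (Not (Eq (a 3 ''i'') (a 3 ''j''))))))"

lemma bval_share_end:
  "bval share_end s \<longleftrightarrow> edge_at (s ''G'') (s ''i'' 0) \<inter> edge_at (s ''G'') (s ''j'' 0) \<noteq> {}"
  unfolding share_end_def Let_def edge_at_def mult_2 bval.simps aval.simps by blast

text \<open>The lengths of walks with at most one edge; \<open>M + 1\<close> takes the place of
  infinity.\<close>

definition init_dist :: com where
  "init_dist = Assign ''D'' (Plus (Cell ''R'' (V ''i'')) (V ''j'')) (N 0) ;;
     If (Eq (V ''i'') (V ''j'')) SKIP
       (If share_end (Assign ''D'' (Plus (Cell ''R'' (V ''i'')) (V ''j'')) (N 1))
         (Assign ''D'' (Plus (Cell ''R'' (V ''i'')) (V ''j'')) (Plus (V ''M'') (N 1))))"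

lemma writes_init_dist [simp]: "writes init_dist = {''D''}"
  by (simp add: init_dist_def)

definition construct_conflict_graph :: com where
  "construct_conflict_graph = (let m = Cell ''G'' (N 1) in
     row_table m ;; fill_matrix m init_dist ;; floyd_warshall m ;;
     emit_graph ''Gc'' m (Not (Less (V ''M'') (entry ''D'' (V ''i'') (V ''j'')))))"

text \<open>The line graph as the program sees it, each edge being replaced by its position in the
  array. It is isomorphic to the line graph because a stored simple graph lists no edge
  twice.\<close>

definition edge_index_graph :: "(nat \<Rightarrow> nat) \<Rightarrow> nat graph" where
  "edge_index_graph a = \<lparr>verts = {..<a 1}, edges = {{i, j} | i j. i < a 1 \<and> j < a 1 \<and> i \<noteq> j \<and>
     edge_at a i \<inter> edge_at a j \<noteq> {}}\<rparr>"

lemma edge_index_graph_edge_iff: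
  "{i, j} \<in> edges (edge_index_graph a) \<longleftrightarrow>
    i < a 1 \<and> j < a 1 \<and> i \<noteq> j \<and> edge_at a i \<inter> edge_at a j \<noteq> {}"
  by (auto simp: edge_index_graph_def doubleton_eq_iff)

lemma adj_edge_index_graph:
  "adj (edge_index_graph a) =
    {(i, j). i < a 1 \<and> j < a 1 \<and> i \<noteq> j \<and> edge_at a i \<inter> edge_at a j \<noteq> {}}"
  unfolding adj_def edge_index_graph_edge_iff by (auto simp: edge_index_graph_def)

lemma graph_iso_edge_index_graph:
  assumes "inj_on (edge_at a) {..<a 1}"
  shows "graph_iso (edge_at a) (edge_index_graph a) (line_graph (graph_of a))"
proof -
  have "edge_at a i = edge_at a j \<longleftrightarrow> i = j" if "i < a 1" "j < a 1" for i j
    using assms that by (auto simp: inj_on_def)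
  then show ?thesis
    using assms unfolding graph_iso_def edge_index_graph_edge_iff line_graph_edge_iff
    by (auto simp: edge_index_graph_def graph_of_def bij_betw_def)
qed

text \<open>Matches the output of \<open>emit_graph\<close>, one order per pair, with the unordered
  edges of the power. Symmetry of \<open>P\<close> is inherited from the power.\<close>

lemma graph_power_edges_ordered:
  fixes X :: "nat graph"
  assumes "verts X = {..<n}"
    and "\<And>i j. i < n \<Longrightarrow> j < n \<Longrightarrow> P i j \<longleftrightarrow> (\<exists>l\<le>t. (i, j) \<in> adj X ^^ l)"
  shows "\<lparr>verts = {..<n}, edges = {{i, j} | i j. i < n \<and> j < i \<and> P i j}\<rparr> = graph_power X t"
proof -
  have "{{i, j} | i j. i < n \<and> j < i \<and> P i j} = edges (graph_power X t)"
  proof (intro set_eqI iffI)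
    fix e
    assume "e \<in> {{i, j} | i j. i < n \<and> j < i \<and> P i j}"
    then obtain i j where "e = {i, j}" "i < n" "j < i" "P i j" by blast
    with assms show "e \<in> edges (graph_power X t)"
      by (simp add: graph_power_edge_iff)
  next
    fix e
    assume e: "e \<in> edges (graph_power X t)"
    then obtain u v where uv: "e = {u, v}"
      by (auto simp: graph_power_def)
    have "{u, v} \<in> edges (graph_power X t)" "{v, u} \<in> edges (graph_power X t)"
      using e uv by (simp_all add: insert_commute)
    then have *: "u < n" "v < n" "u \<noteq> v" "P u v" "P v u"
      using assms unfolding graph_power_edge_iff by auto
    then show "e \<in> {{i, j} | i j. i < n \<and> j < i \<and> P i j}"
      using uv by (cases "u < v") (auto simp: insert_commute)
  qed
  then show ?thesis
    using assms(1) by (simp add: graph_power_def)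
qed

lemma runs_construct_conflict_graph:
  assumes a: "holds_simple_graph (s ''G'')" and B: "s ''G'' 1 < B"
  shows "runs B 3 construct_conflict_graph s (\<lambda>s'. holds_simple_graph (s' ''Gc'') \<and> s' ''Gc'' 0 = s ''G'' 1 \<and>
    isomorphic (graph_of (s' ''Gc'')) (conflict_graph (graph_of (s ''G'')) (s ''M'' 0)))"
proof -
  define n where "n = s ''G'' 1"
  define M where "M = s ''M'' 0"
  let ?X = "edge_index_graph (s ''G'')"
  define E where "E = adj ?X"
  have E_iff: "(i, j) \<in> E \<longleftrightarrow> i < n \<and> j < n \<and> i \<noteq> j \<and> edge_at (s ''G'') i \<inter> edge_at (s ''G'') j \<noteq> {}" for i j
    by (auto simp: E_def adj_edge_index_graph n_def)
  have nB: "n < B" and B0: "0 < B"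
    using B by (simp_all add: n_def)
  let ?m = "Cell ''G'' (N 1)"
  have m: "aval ?m s' = n" if "agree W s s'" "''G'' \<notin> W" for W s'
    using that by (simp add: agree_def n_def)
  let ?W = "{''R'', ''i'', ''j'', ''k'', ''D'', ''e'', ''Gc''}"
  let ?F = "\<lambda>i j. if i = j then 0 else if (i, j) \<in> E then 1 else M + 1"
  show ?thesis
    unfolding construct_conflict_graph_def Let_def
  proof (rule runs_Seq[where R = "\<lambda>s'. \<forall>i\<le>n. s' ''R'' i = i * n"], goal_cases)
    case 1
    show ?case
      by (rule runs_raise[OF runs_row_table]) (use nB m in auto)
  next
    case (2 s1)
    have ag1: "agree ?W s s1"
      using 2(2) by (auto simp: agree_def)
    show ?case
    proof (rule runs_Seq[where R = "\<lambda>s'. \<forall>i<n. \<forall>j<n. s' ''D'' (i * n + j) = ?F i j"], goal_cases)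
      case 1
      show ?case
      proof (rule runs_raise[OF runs_fill_matrix], goal_cases)
        case (4 s')
        show ?case
          by (rule m[OF agree_trans[OF ag1 4, of ?W]]) simp_all
      next
        case (5 i j s')
        have ag: "agree ?W s s'"
          by (rule agree_trans[OF ag1 5(5)]) simp
        have eqs: "s' ''G'' = s ''G''" "s' ''M'' = s ''M''" "s' ''R'' = s1 ''R''"
          using ag 5(5) by (simp_all add: agree_def)
        have R: "s' ''R'' i = i * n"
          using 2(1) 5(1) eqs by simp
        have E': "bval share_end (s'(''D'' := d)) \<longleftrightarrow> edge_at (s ''G'') i \<inter> edge_at (s ''G'') j \<noteq> {}" for d
          using 5 eqs by (simp add: bval_share_end)
        show ?case
          by (rule runs_loop_free)
            (use B0 R E' 5 eqs in \<open>auto simp: init_dist_def E_iff M_def fun_upd_def\<close>)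
      qed (use nB in auto)
    next
      case (2 s2)
      have ag2: "agree ?W s s2"
        by (rule agree_trans[OF ag1 2(2)]) auto
      have R2: "\<forall>i\<le>n. s2 ''R'' i = i * n"
        using 2(2) \<open>\<forall>i\<le>n. s1 ''R'' i = i * n\<close> by (simp add: agree_def)
      show ?case
      proof (rule runs_Seq[where R = "\<lambda>s'. \<forall>i<n. \<forall>j<n.
          s' ''D'' (i * n + j) \<le> M \<longleftrightarrow> (\<exists>l\<le>M. (i, j) \<in> E ^^ l)"], goal_cases)
        case 1
        show ?case
        proof (rule runs_floyd_warshall, goal_cases)
          case (3 s')
          show ?case
            by (rule m[OF agree_trans[OF ag2 3, of ?W]]) simp_all
        next
          case 5
          \<comment> \<open>An entry that is at most \<open>M\<close> is 0 on the diagonal or 1 at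
            an edge, never \<open>M + 1\<close>.\<close>
          show ?case
            using 2(1) by (auto simp: sound_dist_def)
        next
          case (6 i j)
          \<comment> \<open>With no inner vertices allowed, only the rules \<open>refl\<close> and
            \<open>edge\<close> apply.\<close>
          have "s2 ''D'' (i * n + j) \<le> l" if "through E {} i j l" for l
            using that 2(1) 6 by cases auto
          then show ?case
            by (simp add: dist_le_through_def)
        qed (use nB R2 E_iff in auto)
      next
        case (2 s3)
        have ag3: "agree ?W s s3"
          by (rule agree_trans[OF ag2 2(2)]) auto
        have R3: "\<forall>i\<le>n. s3 ''R'' i = i * n"
          using 2(2) R2 by (simp add: agree_def)
        let ?P = "\<lambda>i j. \<exists>l\<le>M. (i, j) \<in> E ^^ l"
        have "runs B 2 (emit_graph ''Gc'' ?m (Not (Less (V ''M'') (entry ''D'' (V ''i'') (V ''j''))))) s3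
          (\<lambda>s'. holds_simple_graph (s' ''Gc'') \<and>
            graph_of (s' ''Gc'') = \<lparr>verts = {..<n}, edges = {{i, j} | i j. i < n \<and> j < i \<and> ?P i j}\<rparr>)"
        proof (rule runs_emit_graph, goal_cases)
          case (3 s')
          show ?case
            by (rule m[OF agree_trans[OF ag3 3, of ?W]]) simp_all
        next
          case (4 s')
          have "s' ''D'' = s3 ''D''" "s' ''R'' = s3 ''R''"
            using 4(1) by (simp_all add: agree_def)
          moreover have "s' ''M'' 0 = M"
            using 4(1) ag3 by (simp add: agree_def M_def)
          ultimately show ?case
            using 2(1) R3 4(2,3) by (simp add: not_less)
        qed (use nB in auto)
        then have "runs B 3 (emit_graph ''Gc'' ?m (Not (Less (V ''M'') (entry ''D'' (V ''i'') (V ''j''))))) s3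
          (\<lambda>s'. holds_simple_graph (s' ''Gc'') \<and>
            graph_of (s' ''Gc'') = \<lparr>verts = {..<n}, edges = {{i, j} | i j. i < n \<and> j < i \<and> ?P i j}\<rparr>)"
          by (rule runs_raise) (use B0 in simp_all)
        then show ?case
        proof (rule runs_conseq)
          fix s'
          assume *: "holds_simple_graph (s' ''Gc'') \<and>
            graph_of (s' ''Gc'') = \<lparr>verts = {..<n}, edges = {{i, j} | i j. i < n \<and> j < i \<and> ?P i j}\<rparr>"
          have "verts (graph_of (s' ''Gc'')) = {..<n}"
            using * by simp
          then have n': "s' ''Gc'' 0 = n"
            by (simp add: graph_of_def)
          have "graph_of (s' ''Gc'') = graph_power ?X M"
            using * graph_power_edges_ordered[of ?X n ?P M]
            by (simp add: edge_index_graph_def n_def E_def)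
          moreover have "graph_iso (edge_at (s ''G'')) (graph_power ?X M) (conflict_graph (graph_of (s ''G'')) M)"
            unfolding conflict_graph_def
            by (rule graph_iso_power[OF graph_iso_edge_index_graph])
              (use a in \<open>simp add: holds_simple_graph_def\<close>)
          ultimately show "holds_simple_graph (s' ''Gc'') \<and> s' ''Gc'' 0 = s ''G'' 1 \<and>
              isomorphic (graph_of (s' ''Gc'')) (conflict_graph (graph_of (s ''G'')) (s ''M'' 0))"
            using * n' unfolding isomorphic_def n_def M_def by auto
        qed
      qed
    qed
  qed
qed


section \<open>Contracting true twins\<close>

text \<open>The diagonal of the matrix is 1, so that two vertices are equal or true twins if and only if
  their rows are equal.\<close>

definition init_adj :: com where
  "init_adj = If (Eq (V ''i'') (V ''j''))
     (Assign ''A'' (Plus (Cell ''R'' (V ''i'')) (V ''j'')) (N 1))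
     (Assign ''A'' (Plus (Cell ''R'' (V ''i'')) (V ''j'')) (N 0))"

definition mark_edge :: com where
  "mark_edge = (let u = Cell ''Gc'' (Plus (N 2) (Plus (V ''k'') (V ''k'')));
      v = Cell ''Gc'' (Plus (N 3) (Plus (V ''k'') (V ''k''))) in
     Assign ''A'' (Plus (Cell ''R'' u) v) (N 1) ;; Assign ''A'' (Plus (Cell ''R'' v) u) (N 1))"

definition same_row_test :: "aexp \<Rightarrow> com" where
  "same_row_test n = Assign ''q'' (N 0) (N 1) ;;
     For ''w'' n (If (Eq (entry ''A'' (Cell ''P'' (V ''k'')) (V ''w'')) (entry ''A'' (V ''u'') (V ''w'')))
       SKIP (Assign ''q'' (N 0) (N 0)))"

text \<open>The value \<open>r = h\<close> means that no representative was found, and it is also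
  the index of the class that \<open>add_to_class\<close> then opens.\<close>

definition find_rep :: "aexp \<Rightarrow> com" where
  "find_rep n = Assign ''r'' (N 0) (V ''h'') ;;
     For ''k'' (V ''h'') (same_row_test n ;;
       If (Eq (V ''q'') (N 1)) (Assign ''r'' (N 0) (V ''k'')) SKIP)"

definition add_to_class :: com where
  "add_to_class = If (Eq (V ''r'') (V ''h''))
     (Assign ''P'' (V ''h'') (V ''u'') ;; Assign ''label'' (V ''h'') (N 1) ;;
       Assign ''h'' (N 0) (Plus (V ''h'') (N 1)))
     (Assign ''label'' (V ''r'') (Plus (Cell ''label'' (V ''r'')) (N 1)))"

definition find_classes :: "aexp \<Rightarrow> com" where
  "find_classes n = Assign ''h'' (N 0) (N 0) ;; For ''u'' n (find_rep n ;; add_to_class)"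

definition contract :: com where
  "contract = (let n = Cell ''Gc'' (N 0) in
     row_table n ;; fill_matrix n init_adj ;; For ''k'' (Cell ''Gc'' (N 1)) mark_edge ;;
     find_classes n ;;
     emit_graph ''H'' (V ''h'')
       (Eq (entry ''A'' (Cell ''P'' (V ''i'')) (Cell ''P'' (V ''j''))) (N 1)))"

lemma writes_contract_parts [simp]:
  "writes mark_edge = {''A''}" "writes init_adj = {''A''}" "writes (same_row_test n) = {''q'', ''w''}"
  "writes (find_rep n) = {''r'', ''k'', ''q'', ''w''}" "writes add_to_class = {''P'', ''label'', ''h''}"
  "writes (find_classes n) = {''h'', ''u'', ''r'', ''k'', ''q'', ''w'', ''P'', ''label''}"
  by (auto simp: mark_edge_def init_adj_def same_row_test_def find_rep_def add_to_class_def
      find_classes_def Let_def)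

text \<open>An entry of the adjacency matrix plus the identity. The argument is a set of edges, not
  a graph, so that a loop invariant can speak of the edges marked so far.\<close>

definition closed_adj_entry :: "nat set set \<Rightarrow> nat \<Rightarrow> nat \<Rightarrow> nat" where
  "closed_adj_entry S u v = (if u = v \<or> {u, v} \<in> S then 1 else 0)"

text \<open>A single loop with a loop-free body whose length may be quadratic in the number of
  vertices: here \<open>runs_For\<close> is used with exponent 2.\<close>

lemma runs_mark_edges:
  assumes a: "simple_graph (graph_of (s ''Gc''))" and n: "s ''Gc'' 0 = n" and B: "0 < B" "s ''Gc'' 1 < B ^ 2"
    and R: "\<forall>i\<le>n. s ''R'' i = i * n"
    and A: "\<And>u v. u < n \<Longrightarrow> v < n \<Longrightarrow> s ''A'' (u * n + v) = closed_adj_entry {} u v"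
  shows "runs B 2 (For ''k'' (Cell ''Gc'' (N 1)) mark_edge) s (\<lambda>s'. \<forall>u<n. \<forall>v<n.
    s' ''A'' (u * n + v) = closed_adj_entry (edges (graph_of (s ''Gc''))) u v)"
proof -
  define a where "a = s ''Gc''"
  define I where "I k s' \<longleftrightarrow> (\<forall>u<n. \<forall>v<n.
    s' ''A'' (u * n + v) = closed_adj_entry (edge_at a ` {..<k}) u v)" for k and s' :: state
  have "runs B (0 + 2) (For ''k'' (Cell ''Gc'' (N 1)) mark_edge) s (I (a 1))"
  proof (rule runs_For, goal_cases)
    case (7 k s')
    define p where "p = a (2 + (k + k))"
    define q where "q = a (3 + (k + k))"
    have e: "edge_at a k = {p, q}"
      unfolding edge_at_def p_def q_def mult_2 ..
    have "edge_at a k \<in> edges (graph_of a)"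
      using 7(1) by (simp add: graph_of_def)
    then have "{p, q} \<subseteq> {..<n}"
      using assms(1) n unfolding a_def[symmetric] e[symmetric] simple_graph_def by (auto simp: graph_of_def)
    then have pq: "p < n" "q < n" by auto
    have "s' ''Gc'' = a" "s' ''R'' = s ''R''"
      using 7(3) by (simp_all add: agree_def a_def)
    then have A': "result mark_edge s' ''A'' = (s' ''A'')(p * n + q := 1, q * n + p := 1)"
      using 7(2) R pq by (simp add: mark_edge_def Let_def p_def q_def)
    show ?case
    proof (rule runs_loop_free)
      have "result mark_edge s' ''A'' (u * n + v) = closed_adj_entry (edge_at a ` {..<Suc k}) u v"
        if uv: "u < n" "v < n" for u v
      proof -
        have "{u, v} \<in> edge_at a ` {..<Suc k} \<longleftrightarrow>
            u = p \<and> v = q \<or> u = q \<and> v = p \<or> {u, v} \<in> edge_at a ` {..<k}"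
          by (simp add: lessThan_Suc e doubleton_eq_iff)
        then show ?thesis
          using uv 7(4) matrix_index_eq_iff[OF uv(2) pq(2), of u p] matrix_index_eq_iff[OF uv(2) pq(1), of u q]
          unfolding A' I_def closed_adj_entry_def by auto
      qed
      then show "I (Suc k) (result mark_edge s')"
        by (simp add: I_def)
    qed (use B in \<open>simp_all add: mark_edge_def Let_def\<close>)
  qed (use B A in \<open>auto simp: I_def a_def agree_def\<close>)
  then have "runs B 2 (For ''k'' (Cell ''Gc'' (N 1)) mark_edge) s (I (a 1))"
    by (simp only: add_0)
  then show ?thesis
    by (rule runs_conseq) (simp add: I_def graph_of_def a_def)
qed

section \<open>Comparing a row with the rows of the representatives\<close>

lemma runs_same_row_test:
  assumes B: "n < B" and b: "\<And>s'. agree {''q'', ''w''} s s' \<Longrightarrow> aval b s' = n"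
    and R: "s ''R'' (s ''P'' (s ''k'' 0)) = x" "s ''R'' (s ''u'' 0) = y"
  shows "runs B 1 (same_row_test b) s (\<lambda>s'. s' ''q'' 0 = 1 \<longleftrightarrow> (\<forall>w<n. s ''A'' (x + w) = s ''A'' (y + w)))"
  unfolding same_row_test_def
proof (rule runs_Seq[where R = "\<lambda>s'. s' ''q'' 0 = 1"], goal_cases)
  case 1
  show ?case by (rule runs_loop_free) (use B in simp_all)
next
  case (2 s1)
  let ?c = "If (Eq (entry ''A'' (Cell ''P'' (V ''k'')) (V ''w'')) (entry ''A'' (V ''u'') (V ''w'')))
       SKIP (Assign ''q'' (N 0) (N 0))"
  have "runs B (0 + 1) (For ''w'' b ?c) s1
    (\<lambda>s'. s' ''q'' 0 = 1 \<longleftrightarrow> (\<forall>w<n. s ''A'' (x + w) = s ''A'' (y + w)))"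
  proof (rule runs_For[where I = "\<lambda>i s'. s' ''q'' 0 = 1 \<longleftrightarrow> (\<forall>w<i. s ''A'' (x + w) = s ''A'' (y + w))"], goal_cases)
    case (4 s')
    show ?case
      by (rule b, rule agree_trans[OF 2(2) 4]) simp
  next
    case (7 i s')
    have ag: "agree {''q'', ''w''} s s'"
      by (rule agree_trans[OF 2(2) 7(3)]) simp
    show ?case
      by (rule runs_loop_free) (use B 7(1,2,4) ag R in \<open>auto simp: agree_def less_Suc_eq\<close>)
  qed (use B 2 in auto)
  then show ?case by simp
qed

text \<open>\<open>nb\<close> is any function that separates rows exactly as their entries do; it
  becomes \<open>closed_nbhd\<close> later. This keeps graph theory out of the search.\<close>

lemma runs_find_rep:
  assumes B: "n < B" and b: "\<And>s'. agree {''r'', ''k'', ''q'', ''w''} s s' \<Longrightarrow> aval b s' = n"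
    and R: "\<forall>i\<le>n. s ''R'' i = i * n" and h: "s ''h'' 0 \<le> n" "\<And>k. k < s ''h'' 0 \<Longrightarrow> s ''P'' k < n"
    and u: "s ''u'' 0 = u" "u < n"
    and nb: "\<And>p. p < n \<Longrightarrow> (\<forall>w<n. s ''A'' (p * n + w) = s ''A'' (u * n + w)) \<longleftrightarrow> nb p = nb u"
  shows "runs B 2 (find_rep b) s (\<lambda>s'.
    s' ''r'' 0 = s ''h'' 0 \<and> (\<forall>k<s ''h'' 0. nb (s ''P'' k) \<noteq> nb u) \<or>
    s' ''r'' 0 < s ''h'' 0 \<and> nb (s ''P'' (s' ''r'' 0)) = nb u)"
  unfolding find_rep_def
proof (rule runs_Seq[where R = "\<lambda>s'. s' ''r'' 0 = s ''h'' 0"], goal_cases)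
  case 1
  show ?case by (rule runs_loop_free) (use B in simp_all)
next
  case (2 s1)
  let ?W = "{''r'', ''k'', ''q'', ''w''}"
  let ?c = "same_row_test b ;; If (Eq (V ''q'') (N 1)) (Assign ''r'' (N 0) (V ''k'')) SKIP"
  let ?I = "\<lambda>i s'. s' ''r'' 0 = s ''h'' 0 \<and> (\<forall>k<i. nb (s ''P'' k) \<noteq> nb u) \<or>
    s' ''r'' 0 < s ''h'' 0 \<and> nb (s ''P'' (s' ''r'' 0)) = nb u"
  have ag1: "agree ?W s s1"
    using 2(2) by (simp add: agree_def)
  have "runs B (1 + 1) (For ''k'' (V ''h'') ?c) s1 (?I (s ''h'' 0))"
  proof (rule runs_For[where I = ?I], goal_cases)
    case (7 i s')
    have ag: "agree ?W s s'"
      by (rule agree_trans[OF ag1 7(3)]) auto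
    have eqs: "s' ''R'' = s ''R''" "s' ''A'' = s ''A''" "s' ''P'' = s ''P''" "s' ''u'' = s ''u''"
      using ag by (simp_all add: agree_def)
    have p: "s ''P'' i < n"
      using h 7(1) by blast
    show ?case
    proof (rule runs_Seq[OF runs_same_row_test[where n = n and x = "s ''P'' i * n" and y = "u * n"]], goal_cases)
      case (2 s'')
      show ?case
        by (rule b, rule agree_trans[OF ag 2]) auto
    next
      case (5 s'')
      have q: "s'' ''q'' 0 = 1 \<longleftrightarrow> nb (s ''P'' i) = nb u"
        using 5(1) nb[OF p] by (simp add: eqs)
      have k: "s'' ''k'' 0 = i" "s'' ''r'' = s' ''r''"
        using 5(2) 7(2) by (simp_all add: agree_def)
      show ?case
        by (rule runs_loop_free) (use B 7(1,4) k q in \<open>auto simp: less_Suc_eq\<close>)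
    qed (use B eqs R p u 7(2) in auto)
  qed (use B 2 ag1 h in \<open>auto simp: agree_def\<close>)
  then show ?case by (simp add: numeral_2_eq_2)
qed

text \<open>A system of distinct representatives \<open>P\<close> for the fibres of
  \<open>nb\<close> on the first \<open>n\<close> vertices, with the fibre sizes \<open>L\<close>.
  The parameter \<open>n\<close> follows the loop counter, each pass adding one vertex.\<close>

definition class_reps :: "(nat \<Rightarrow> 'a) \<Rightarrow> nat \<Rightarrow> nat \<Rightarrow> (nat \<Rightarrow> nat) \<Rightarrow> (nat \<Rightarrow> nat) \<Rightarrow> bool" where
  "class_reps nb n h P L \<longleftrightarrow> h \<le> n \<and> (\<forall>k<h. P k < n) \<and>
     (\<forall>k<h. \<forall>l<h. nb (P k) = nb (P l) \<longrightarrow> k = l) \<and>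
     (\<forall>v<n. \<exists>k<h. nb v = nb (P k)) \<and> (\<forall>k<h. L k = card {v. v < n \<and> nb v = nb (P k)})"

lemma class_members_Suc:
  "{v. v < Suc n \<and> nb v = c} = (if nb n = c then insert n {v. v < n \<and> nb v = c} else {v. v < n \<and> nb v = c})"
  by (auto simp: less_Suc_eq)

lemma class_reps_new:
  assumes reps: "class_reps nb n h P L" and new: "\<forall>k<h. nb (P k) \<noteq> nb n"
  shows "class_reps nb (Suc n) (Suc h) (P(h := n)) (L(h := Suc 0))"
proof -
  \<comment> \<open>Every earlier vertex shares its value with a representative, and none of these
    has the value of \<open>n\<close>; the new class starts as a singleton.\<close>
  have "{v. v < n \<and> nb v = nb n} = {}"
    using reps new unfolding class_reps_def by (metis (mono_tags, lifting) Collect_empty_eq)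
  then have "card {v. v < Suc n \<and> nb v = nb n} = Suc 0"
    unfolding class_members_Suc by simp
  moreover have "L k = card {v. v < Suc n \<and> nb v = nb (P k)}" if "k < h" for k
    using reps new that unfolding class_members_Suc by (simp add: class_reps_def) metis
  moreover have "\<exists>k<Suc h. nb v = nb ((P(h := n)) k)" if "v < Suc n" for v
  proof (cases "v = n")
    case False
    then obtain k where "k < h" "nb v = nb (P k)"
      using reps \<open>v < Suc n\<close> unfolding class_reps_def by (metis less_SucE)
    then show ?thesis by (intro exI[of _ k]) simp
  qed auto
  ultimately show ?thesis
    using reps new unfolding class_reps_def by (auto simp: less_Suc_eq)
qed

lemma class_reps_old:
  assumes reps: "class_reps nb n h P L" and r: "r < h" "nb (P r) = nb n"
  shows "class_reps nb (Suc n) h P (L(r := Suc (L r)))"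
proof -
  have "(L(r := Suc (L r))) k = card {v. v < Suc n \<and> nb v = nb (P k)}" if k: "k < h" for k
  proof -
    \<comment> \<open>Representatives have different values, so exactly one label grows.\<close>
    have "nb n = nb (P k) \<longleftrightarrow> k = r"
      using reps r k unfolding class_reps_def by metis
    then show ?thesis
      using reps k unfolding class_members_Suc by (simp add: class_reps_def)
  qed
  moreover have "\<exists>k<h. nb v = nb (P k)" if "v < Suc n" for v
    using reps r that unfolding class_reps_def by (metis less_SucE)
  moreover have "h \<le> Suc n" "\<forall>k<h. P k < Suc n" "\<forall>k<h. \<forall>l<h. nb (P k) = nb (P l) \<longrightarrow> k = l"
    using reps by (simp_all add: class_reps_def less_Suc_eq)
  ultimately show ?thesis
    unfolding class_reps_def by blast
qed

lemma runs_find_classes: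
  assumes B: "n < B" and b: "\<And>s'. agree (writes (find_classes b)) s s' \<Longrightarrow> aval b s' = n"
    and R: "\<forall>i\<le>n. s ''R'' i = i * n"
    and nb: "\<And>p u. p < n \<Longrightarrow> u < n \<Longrightarrow>
      (\<forall>w<n. s ''A'' (p * n + w) = s ''A'' (u * n + w)) \<longleftrightarrow> nb p = nb u"
  shows "runs B 3 (find_classes b) s (\<lambda>s'. class_reps nb n (s' ''h'' 0) (s' ''P'') (s' ''label''))"
proof -
  let ?W = "writes (find_classes b)"
  let ?I = "\<lambda>n s'. class_reps nb n (s' ''h'' 0) (s' ''P'') (s' ''label'')"
  show ?thesis
    unfolding find_classes_def
  proof (rule runs_Seq[where R = "\<lambda>s'. s' ''h'' 0 = 0"], goal_cases)
    case 1
    show ?case by (rule runs_loop_free) (use B in simp_all)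
  next
    case (2 s1)
    have ag1: "agree ?W s s1"
      using 2(2) by (simp add: agree_def)
    have "runs B (2 + 1) (For ''u'' b (find_rep b ;; add_to_class)) s1 (?I n)"
    proof (rule runs_For[where I = ?I], goal_cases)
      case (4 s')
      show ?case
        by (rule b, rule agree_trans[OF ag1 4]) auto
    next
      case (7 i s')
      have ag: "agree ?W s s'"
        by (rule agree_trans[OF ag1 7(3)]) auto
      have eqs: "s' ''R'' = s ''R''" "s' ''A'' = s ''A''"
        using ag by (simp_all add: agree_def)
      have hP: "s' ''h'' 0 \<le> n" "s' ''P'' k < n" if "k < s' ''h'' 0" for k
        using 7(1,4) that by (fastforce simp: class_reps_def)+
      have h: "s' ''h'' 0 \<le> n"
        using 7(1,4) by (simp add: class_reps_def)
      show ?case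
      proof (rule runs_Seq[OF runs_find_rep[where n = n and u = i and nb = nb]], goal_cases)
        case (2 s'')
        show ?case
          by (rule b, rule agree_trans[OF ag 2]) auto
      next
        case (9 s'')
        have eqs': "s'' ''h'' = s' ''h''" "s'' ''P'' = s' ''P''" "s'' ''label'' = s' ''label''" "s'' ''u'' = s' ''u''"
          using 9(2) by (simp_all add: agree_def)
        show ?case
        proof (rule runs_loop_free)
          show "?I (Suc i) (result add_to_class s'')"
            using 9(1) class_reps_new[OF 7(4)] class_reps_old[OF 7(4)] 7(2) eqs'
            by (auto simp: add_to_class_def)
        qed (use B in \<open>simp_all add: add_to_class_def\<close>)
      qed (use B R hP h nb eqs 7(1,2) in auto)
    qed (use B 2 in \<open>auto simp: class_reps_def\<close>)
    then show ?case by simp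
  qed
qed

text \<open>The entries are 0 or 1, so a row is the characteristic function of a closed
  neighbourhood.\<close>

lemma closed_nbhd_graph_of_eq_iff:
  assumes "p < a 0" and "u < a 0"
  shows "(\<forall>w<a 0. closed_adj_entry (edges (graph_of a)) p w = closed_adj_entry (edges (graph_of a)) u w) \<longleftrightarrow>
    closed_nbhd (graph_of a) p = closed_nbhd (graph_of a) u"
proof -
  have *: "closed_nbhd (graph_of a) p = {w. w < a 0 \<and> closed_adj_entry (edges (graph_of a)) p w = 1}"
    if "p < a 0" for p
    using that by (auto simp: closed_nbhd_def closed_adj_entry_def graph_of_def)
  have "closed_adj_entry S u v = 0 \<or> closed_adj_entry S u v = 1" for S u v
    by (simp add: closed_adj_entry_def)
  then show ?thesis
    unfolding *[OF assms(1)] *[OF assms(2)] set_eq_iff mem_Collect_eq by metis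
qed

text \<open>By \<open>contraction_edge_iff\<close>, adjacency of classes can be read at their
  representatives. The ones on the diagonal create no edges, since different indices have different
  representatives.\<close>

lemma contraction_iso_class_reps:
  assumes reps: "class_reps (closed_nbhd (graph_of a)) (a 0) h P L"
    and simple: "simple_graph (graph_of a)"
    and H: "H = \<lparr>verts = {..<h}, edges = {{i, j} | i j. i < h \<and> j < i \<and>
      closed_adj_entry (edges (graph_of a)) (P i) (P j) = 1}\<rparr>"
  shows "graph_iso (\<lambda>k. twin_class (graph_of a) (P k)) H (contraction (graph_of a))"
    and "\<And>k. k < h \<Longrightarrow> L k = card (twin_class (graph_of a) (P k))"
proof -
  let ?X = "graph_of a"
  let ?f = "\<lambda>k. twin_class ?X (P k)"
  have X: "verts ?X = {..<a 0}"
    by (simp add: graph_of_def)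
  have P: "P k \<in> verts ?X" if "k < h" for k
    using reps that by (simp add: class_reps_def X)
  have inj: "?f k = ?f l \<longleftrightarrow> k = l" if "k < h" "l < h" for k l
    using reps that twin_class_eq_iff[OF P[OF that(1)] P[OF that(2)]] unfolding class_reps_def by metis
  show "L k = card (?f k)" if "k < h" for k
    using reps that unfolding twin_class_eq[OF P[OF that]] by (simp add: class_reps_def X)
  have "twin_class ?X v \<in> ?f ` {..<h}" if v: "v \<in> verts ?X" for v
  proof -
    obtain k where "k < h" "closed_nbhd ?X v = closed_nbhd ?X (P k)"
      using reps v unfolding class_reps_def X by auto
    then show ?thesis
      using twin_class_eq_iff[OF v P] by auto
  qed
  then have "bij_betw ?f {..<h} (twin_class ?X ` verts ?X)"
    using inj P by (auto simp: bij_betw_def inj_on_def)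
  moreover have "{k, l} \<in> edges H \<longleftrightarrow> {?f k, ?f l} \<in> edges (contraction ?X)"
    if kl: "k < h" "l < h" for k l
  proof -
    have sym: "closed_adj_entry (edges ?X) x y = closed_adj_entry (edges ?X) y x" for x y
      by (auto simp: closed_adj_entry_def insert_commute)
    have "{k, l} \<in> edges H \<longleftrightarrow> k \<noteq> l \<and> closed_adj_entry (edges ?X) (P k) (P l) = 1"
    proof
      assume "{k, l} \<in> edges H"
      then obtain i j where "{k, l} = {i, j}" "j < i" "closed_adj_entry (edges ?X) (P i) (P j) = 1"
        unfolding H by auto
      then show "k \<noteq> l \<and> closed_adj_entry (edges ?X) (P k) (P l) = 1"
        using sym[of "P i" "P j"] by (auto simp: doubleton_eq_iff)
    next
      assume *: "k \<noteq> l \<and> closed_adj_entry (edges ?X) (P k) (P l) = 1"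
      show "{k, l} \<in> edges H"
      proof (cases "k < l")
        case True
        then have "l < h \<and> k < l \<and> closed_adj_entry (edges ?X) (P l) (P k) = 1"
          using * kl sym[of "P k" "P l"] by simp
        then show ?thesis
          unfolding H by (auto simp: insert_commute)
      next
        case False
        then have "k < h \<and> l < k \<and> closed_adj_entry (edges ?X) (P k) (P l) = 1"
          using * kl by simp
        then show ?thesis
          unfolding H by auto
      qed
    qed
    moreover have "P k \<noteq> P l" if "k \<noteq> l"
      using inj[OF kl] that by auto
    ultimately show ?thesis
      using contraction_edge_iff[OF P[OF kl(1)] P[OF kl(2)]] inj[OF kl]
      by (auto simp: closed_adj_entry_def)
  qed
  ultimately show "graph_iso ?f H (contraction ?X)"
    unfolding graph_iso_def by (simp add: H contraction_def)
qed

lemma card_edges_graph_of: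
  "holds_simple_graph a \<Longrightarrow> card (edges (graph_of a)) = a 1"
  by (simp add: holds_simple_graph_def graph_of_def card_image)

lemma runs_contract:
  assumes a: "holds_simple_graph (s ''Gc'')" and B: "s ''Gc'' 0 < B"
  shows "runs B 3 contract s (\<lambda>s'. holds_simple_graph (s' ''H'') \<and>
    (\<exists>f. graph_iso f (graph_of (s' ''H'')) (contraction (graph_of (s ''Gc''))) \<and>
      (\<forall>k<s' ''H'' 0. s' ''label'' k = card (f k))))"
proof -
  define a where "a = s ''Gc''"
  define n where "n = a 0"
  let ?X = "graph_of a"
  let ?S = "edges ?X"
  have simple: "simple_graph ?X"
    using assms(1) by (simp add: holds_simple_graph_def a_def)
  have nB: "n < B" and B0: "0 < B"
    using B by (simp_all add: n_def a_def)
  have "a 1 \<le> n * n"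
    using simple_graph_card_edges_le[OF simple] card_edges_graph_of assms(1)
    by (simp add: a_def n_def graph_of_def)
  also have "\<dots> < B ^ 2"
    using nB by (simp add: power2_eq_square mult_strict_mono)
  finally have a1: "a 1 < B ^ 2" .
  let ?n = "Cell ''Gc'' (N 0)"
  have m: "aval ?n s' = n" if "agree W s s'" "''Gc'' \<notin> W" for W s'
    using that by (simp add: agree_def n_def a_def)
  let ?W = "{''R'', ''i'', ''j'', ''k'', ''A'', ''h'', ''u'', ''r'', ''q'', ''w'', ''P'', ''label'', ''e'', ''H''}"
  let ?t = "Eq (entry ''A'' (Cell ''P'' (V ''i'')) (Cell ''P'' (V ''j''))) (N 1)"
  show ?thesis
    unfolding contract_def Let_def
  proof (rule runs_Seq[where R = "\<lambda>s'. \<forall>i\<le>n. s' ''R'' i = i * n"], goal_cases)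
    case 1
    show ?case
      by (rule runs_raise[OF runs_row_table]) (use nB m in auto)
  next
    case (2 s1)
    have ag1: "agree ?W s s1"
      using 2(2) by (auto simp: agree_def)
    note R1 = 2(1)
    show ?case
    proof (rule runs_Seq[where R = "\<lambda>s'. \<forall>u<n. \<forall>v<n. s' ''A'' (u * n + v) = closed_adj_entry {} u v"], goal_cases)
      case 1
      show ?case
      proof (rule runs_raise[OF runs_fill_matrix], goal_cases)
        case (4 s')
        show ?case
          by (rule m[OF agree_trans[OF ag1 4, of ?W]]) simp_all
      next
        case (5 i j s')
        have "s' ''R'' i = i * n"
          using 5(1,5) R1 by (simp add: agree_def)
        then show ?case
          by (intro runs_loop_free) (use B0 5 in \<open>auto simp: init_adj_def closed_adj_entry_def\<close>)
      qed (use nB in auto)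
    next
      case (2 s2)
      have ag2: "agree ?W s s2"
        by (rule agree_trans[OF ag1 2(2)]) auto
      have R2: "\<forall>i\<le>n. s2 ''R'' i = i * n"
        using 2(2) R1 by (simp add: agree_def)
      have a2: "s2 ''Gc'' = a"
        using ag2 by (simp add: agree_def a_def)
      show ?case
      proof (rule runs_Seq[where R = "\<lambda>s'. \<forall>u<n. \<forall>v<n. s' ''A'' (u * n + v) = closed_adj_entry ?S u v"], goal_cases)
        case 1
        have "runs B 2 (For ''k'' (Cell ''Gc'' (N 1)) mark_edge) s2 (\<lambda>s'. \<forall>u<n. \<forall>v<n.
            s' ''A'' (u * n + v) = closed_adj_entry (edges (graph_of (s2 ''Gc''))) u v)"
          by (rule runs_mark_edges) (use a2 simple n_def B0 a1 R2 2(1) in simp_all)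
        then show ?case
          unfolding a2 by (rule runs_raise) (use B0 in simp_all)
      next
        case (2 s3)
        have ag3: "agree ?W s s3"
          by (rule agree_trans[OF ag2 2(2)]) auto
        have R3: "\<forall>i\<le>n. s3 ''R'' i = i * n"
          using 2(2) R2 by (simp add: agree_def)
        note A3 = 2(1)
        show ?case
        proof (rule runs_Seq[where R = "\<lambda>s'. class_reps (closed_nbhd ?X) n (s' ''h'' 0) (s' ''P'') (s' ''label'')"], goal_cases)
          case 1
          show ?case
          proof (rule runs_find_classes, goal_cases)
            case (2 s')
            show ?case
              by (rule m[OF agree_trans[OF ag3 2, of ?W]]) auto
          next
            case (4 p u)
            then show ?case
              using A3 closed_nbhd_graph_of_eq_iff[of p a u] by (simp add: n_def)
          qed (use nB R3 in auto)
        next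
          case (2 s4)
          define h where "h = s4 ''h'' 0"
          define P where "P = s4 ''P''"
          have reps: "class_reps (closed_nbhd ?X) n h P (s4 ''label'')"
            using 2(1) by (simp add: h_def P_def)
          have eqs: "s4 ''R'' = s3 ''R''" "s4 ''A'' = s3 ''A''"
            using 2(2) by (simp_all add: agree_def)
          let ?P = "\<lambda>i j. closed_adj_entry ?S (P i) (P j) = 1"
          have "runs B 2 (emit_graph ''H'' (V ''h'') ?t) s4 (\<lambda>s'. holds_simple_graph (s' ''H'') \<and>
              graph_of (s' ''H'') = \<lparr>verts = {..<h}, edges = {{i, j} | i j. i < h \<and> j < i \<and> ?P i j}\<rparr>)"
          proof (rule runs_emit_graph, goal_cases)
            case 1
            show ?case
              using reps nB by (simp add: class_reps_def)
          next
            case (4 s')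
            have eqs': "s' ''R'' = s4 ''R''" "s' ''A'' = s4 ''A''" "s' ''P'' = P"
              using 4(1) by (simp_all add: agree_def P_def)
            have "P (s' ''i'' 0) < n" "P (s' ''j'' 0) < n"
              using reps 4(2,3) by (simp_all add: class_reps_def)
            then show ?case
              using A3 R3 by (simp add: eqs eqs')
          qed (auto simp: agree_def h_def)
          then have "runs B 3 (emit_graph ''H'' (V ''h'') ?t) s4 (\<lambda>s'. holds_simple_graph (s' ''H'') \<and>
              graph_of (s' ''H'') = \<lparr>verts = {..<h}, edges = {{i, j} | i j. i < h \<and> j < i \<and> ?P i j}\<rparr>)"
            by (rule runs_raise) (use B0 in simp_all)
          then show ?case
          proof (rule runs_conseq)
            fix s'
            assume *: "holds_simple_graph (s' ''H'') \<and>
              graph_of (s' ''H'') = \<lparr>verts = {..<h}, edges = {{i, j} | i j. i < h \<and> j < i \<and> ?P i j}\<rparr>"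
              and "agree (writes (emit_graph ''H'' (V ''h'') ?t)) s4 s'"
            then have label: "s' ''label'' = s4 ''label''"
              by (simp add: agree_def)
            have "verts (graph_of (s' ''H'')) = {..<h}"
              using * by simp
            then have h': "s' ''H'' 0 = h"
              by (simp add: graph_of_def)
            note iso = contraction_iso_class_reps[OF reps[unfolded n_def] simple conjunct2[OF *]]
            show "holds_simple_graph (s' ''H'') \<and>
              (\<exists>f. graph_iso f (graph_of (s' ''H'')) (contraction (graph_of (s ''Gc''))) \<and>
                (\<forall>k<s' ''H'' 0. s' ''label'' k = card (f k)))"
              using * iso unfolding h' label a_def by blast
          qed
        qed
      qed
    qed
  qed
qed


section \<open>Multiplying the edges of the root\<close>

definition copy_edge :: com where
  "copy_edge = append_edge ''out''
     (Cell ''root'' (Plus (N 2) (Plus (V ''k'') (V ''k''))))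
     (Cell ''root'' (Plus (N 3) (Plus (V ''k'') (V ''k''))))"

definition multiply_edges :: com where
  "multiply_edges = If (Eq (V ''found'') (N 1))
     (Assign ''e'' (N 0) (N 0) ;;
      For ''k'' (Cell ''root'' (N 1)) (For ''l'' (Cell ''label'' (V ''k'')) copy_edge) ;;
      Assign ''out'' (N 0) (V ''root'') ;; Assign ''out'' (N 1) (V ''e''))
     SKIP"

text \<open>The array \<open>''root''\<close> is meaningful only if a root was found, so the bounds
  are assumed only then. Bounding each label by \<open>B\<close> already makes the nested loops
  quadratic, although the number of copies is only the sum of the labels.\<close>

lemma runs_multiply_edges:
  assumes B: "0 < B" and n: "s ''found'' 0 = 1 \<Longrightarrow> s ''root'' 1 < B"
    and L: "\<And>k. s ''found'' 0 = 1 \<Longrightarrow> k < s ''root'' 1 \<Longrightarrow> s ''label'' k < B"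
  shows "runs B 2 multiply_edges s (\<lambda>s'. s' ''found'' 0 = s ''found'' 0 \<and>
    (s ''found'' 0 = 1 \<longrightarrow> s' ''out'' 0 = s ''root'' 0 \<and>
      (\<exists>\<beta>. bij_betw \<beta> {..<s' ''out'' 1} (SIGMA k:{..<s ''root'' 1}. {..<s ''label'' k}) \<and>
         (\<forall>j<s' ''out'' 1. edge_at (s' ''out'') j = edge_at (s ''root'') (fst (\<beta> j))))))"
    (is "runs B 2 multiply_edges s ?Q")
  unfolding multiply_edges_def
proof (rule runs_If, goal_cases)
  case 1
  show ?case by (rule B)
next
  case 2
  then have found: "s ''found'' 0 = 1" by simp
  define r where "r = s ''root''"
  define L' where "L' = s ''label''"
  \<comment> \<open>The copies made so far: all copies of the edges before \<open>k\<close> and the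
    first \<open>l\<close> copies of edge \<open>k\<close>.\<close>
  define K where "K k l = (SIGMA k:{..<k}. {..<L' k}) \<union> {k} \<times> {..<l}" for k l
  define I where "I k l s' \<longleftrightarrow> (\<exists>\<beta>. bij_betw \<beta> {..<s' ''e'' 0} (K k l) \<and>
    (\<forall>j<s' ''e'' 0. edge_at (s' ''out'') j = edge_at r (fst (\<beta> j))))" for k l and s' :: state
  let ?W = "{''e'', ''k'', ''l'', ''out''}"
  let ?c = "copy_edge"
  have w: "insert ''k'' (insert ''l'' (writes copy_edge)) = ?W"
    by (auto simp: copy_edge_def)
  show ?case
  proof (rule runs_Seq[where R = "I 0 0"], goal_cases)
    case 1
    show ?case
      by (rule runs_loop_free) (use B in \<open>auto simp: I_def K_def bij_betw_def\<close>)
  next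
    case (2 s1)
    have ag1: "agree ?W s s1"
      using 2(2) by (simp add: agree_def)
    show ?case
    proof (rule runs_Seq[where R = "I (r 1) 0"], goal_cases)
      case 1
      have "runs B (0 + 2) (For ''k'' (Cell ''root'' (N 1)) (For ''l'' (Cell ''label'' (V ''k'')) ?c)) s1 (I (r 1) 0)"
      proof (rule runs_For2[where m = L'], goal_cases)
        case (6 s')
        have "agree ?W s s'"
          by (rule agree_trans[OF ag1 6[unfolded w]]) simp
        then show ?case
          by (simp add: agree_def r_def)
      next
        case (7 i s')
        have "agree ?W s s'"
          by (rule agree_trans[OF ag1 7(3)[unfolded w]]) simp
        then show ?case
          using 7(2) by (simp add: agree_def L'_def)
      next
        case (11 i j s')
        have ag: "agree ?W s s'"
          by (rule agree_trans[OF ag1 11(5)[unfolded w]]) simp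
        then have root: "s' ''root'' = r"
          by (simp add: agree_def r_def)
        obtain \<beta> where \<beta>: "inj_on \<beta> {..<s' ''e'' 0}" "\<beta> ` {..<s' ''e'' 0} = K i j"
            "\<And>k. k < s' ''e'' 0 \<Longrightarrow> edge_at (s' ''out'') k = edge_at r (fst (\<beta> k))"
          using 11(6) by (auto simp: I_def bij_betw_def)
        have new: "(i, j) \<notin> K i j" "K i (Suc j) = insert (i, j) (K i j)"
          by (auto simp: K_def less_Suc_eq)
        let ?\<beta> = "\<beta>(s' ''e'' 0 := (i, j))"
        have b: "bij_betw ?\<beta> {..<Suc (s' ''e'' 0)} (K i (Suc j))"
          unfolding bij_betw_def inj_on_fun_upd_lessThan_Suc image_fun_upd_lessThan_Suc
          using \<beta> new by simp
        have ends: "aval (Cell ''root'' (Plus (N 2) (Plus (V ''k'') (V ''k'')))) s' = r (2 + (i + i))"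
            "aval (Cell ''root'' (Plus (N 3) (Plus (V ''k'') (V ''k'')))) (s'(''out'' := f)) = r (3 + (i + i))" for f
          using 11(3) by (simp_all add: root)
        have out: "''out'' \<noteq> ''e''" by simp
        have e: "{r (2 + (i + i)), r (3 + (i + i))} = edge_at r i"
          by (simp only: edge_at_def mult_2)
        show ?case
        proof (rule runs_loop_free)
          show "I i (Suc j) (result copy_edge s')"
            unfolding I_def copy_edge_def result_append_edge[OF out ends] e
            by (rule exI[of _ ?\<beta>]) (use b \<beta>(3) in \<open>auto simp: less_Suc_eq\<close>)
        qed (use B in \<open>simp_all add: copy_edge_def append_edge_def\<close>)
      next
        case (12 i s')
        have "K i (L' i) = K (Suc i) 0"
          by (auto simp: K_def less_Suc_eq)
        then show ?case
          using 12(2) by (simp add: I_def)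
      qed (use B n L found 2 in \<open>auto simp: I_def r_def L'_def copy_edge_def\<close>)
      then show ?case
        by (simp only: add_0)
    next
      case (2 s2)
      have "agree ?W s s2"
        by (rule agree_trans[OF ag1 2(2)]) (simp add: copy_edge_def)
      then have eqs: "s2 ''root'' = r" "s2 ''found'' = s ''found''"
        by (simp_all add: agree_def r_def)
      have K: "K (r 1) 0 = (SIGMA k:{..<r 1}. {..<L' k})"
        by (simp add: K_def)
      define s3 where "s3 = result (Assign ''out'' (N 0) (V ''root'') ;; Assign ''out'' (N 1) (V ''e'')) s2"
      have s3: "s3 ''out'' 0 = r 0" "s3 ''out'' 1 = s2 ''e'' 0" "edge_at (s3 ''out'') = edge_at (s2 ''out'')"
          "s3 ''found'' = s ''found''"
        using eqs by (simp_all add: s3_def)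
      show ?case
      proof (rule runs_loop_free)
        have "?Q s3"
          using 2(1) unfolding I_def K s3 r_def[symmetric] L'_def[symmetric] by blast
        then show "?Q (result (Assign ''out'' (N 0) (V ''root'') ;; Assign ''out'' (N 1) (V ''e'')) s2)"
          unfolding s3_def .
      qed (use B in simp_all)
    qed
  qed
next
  case 3
  then show ?case
    by (intro runs_loop_free) (use B in simp_all)
qed

section \<open>The first and third steps meet their specifications\<close>

lemma contracts_true_twins_contract: "contracts_true_twins contract"
  unfolding contracts_true_twins_def
proof (intro allI impI)
  fix s :: state
  assume "holds_simple_graph (s ''Gc'')"
  from runs_contract[where s = s and B = "Suc (s ''Gc'' 0)", OF this lessI]
  show "\<exists>t s' f. exec contract s t s' \<and> holds_simple_graph (s' ''H'') \<and>
      graph_iso f (graph_of (s' ''H'')) (contraction (graph_of (s ''Gc''))) \<and>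
      (\<forall>k<s' ''H'' 0. s' ''label'' k = card (f k))"
    unfolding runs_def by blast
qed

lemma multiplies_edges_multiply_edges: "multiplies_edges multiply_edges"
  unfolding multiplies_edges_def
proof (intro allI impI)
  fix s :: state
  \<comment> \<open>The specification bounds neither labels nor time, so any base above the number
    of root edges and above every label will do; the sum dominates each label.\<close>
  define B where "B = Suc (s ''root'' 1 + (\<Sum>k<s ''root'' 1. s ''label'' k))"
  have "s ''label'' k < B" if "k < s ''root'' 1" for k
  proof -
    have "s ''label'' k \<le> (\<Sum>k<s ''root'' 1. s ''label'' k)"
      using that by (intro member_le_sum) auto
    then show ?thesis
      by (simp add: B_def)
  qed
  then have "runs B 2 multiply_edges s (\<lambda>s'. s' ''found'' 0 = s ''found'' 0 \<and>
    (s ''found'' 0 = 1 \<longrightarrow> s' ''out'' 0 = s ''root'' 0 \<and>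
      (\<exists>\<beta>. bij_betw \<beta> {..<s' ''out'' 1} (SIGMA k:{..<s ''root'' 1}. {..<s ''label'' k}) \<and>
         (\<forall>j<s' ''out'' 1. edge_at (s' ''out'') j = edge_at (s ''root'') (fst (\<beta> j))))))"
    by (intro runs_multiply_edges) (auto simp: B_def)
  then show "\<exists>t s'. exec multiply_edges s t s' \<and> s' ''found'' 0 = s ''found'' 0 \<and>
    (s ''found'' 0 = 1 \<longrightarrow> s' ''out'' 0 = s ''root'' 0 \<and>
      (\<exists>\<beta>. bij_betw \<beta> {..<s' ''out'' 1} (SIGMA k:{..<s ''root'' 1}. {..<s ''label'' k}) \<and>
         (\<forall>j<s' ''out'' 1. edge_at (s' ''out'') j = edge_at (s ''root'') (fst (\<beta> j)))))"
    unfolding runs_def by blast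
qed


section \<open>Total running time\<close>

text \<open>A bound for every \<open>n\<close>, not only for large ones: the finitely many early
  values are absorbed into the constant. The summand 1 covers \<open>n = 0\<close>, where a purely
  linear bound would force \<open>f 0 \<le> 0\<close>.\<close>

lemma bigo_linear_bound:
  fixes f :: "nat \<Rightarrow> real"
  assumes "f \<in> O(\<lambda>n. real n)"
  obtains c where "0 \<le> c" "\<And>n. f n \<le> c * (real n + 1)"
proof -
  obtain c where c: "0 < c" "eventually (\<lambda>n. norm (f n) \<le> c * norm (real n)) at_top"
    using assms by (elim landau_o.bigE)
  then obtain n0 where n0: "\<And>n. n0 \<le> n \<Longrightarrow> \<bar>f n\<bar> \<le> c * real n"
    by (auto simp: eventually_at_top_linorder)
  define d where "d = c + (\<Sum>n<n0. \<bar>f n\<bar>)"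
  have sum0: "0 \<le> (\<Sum>n<n0. \<bar>f n\<bar>)"
    by (simp add: sum_nonneg)
  have "f n \<le> d * (real n + 1)" for n
  proof (cases "n < n0")
    case True
    have "f n \<le> \<bar>f n\<bar>" by simp
    also have "\<dots> \<le> (\<Sum>n<n0. \<bar>f n\<bar>)"
      using True by (intro member_le_sum) auto
    also have "\<dots> \<le> d * 1"
      using c by (simp add: d_def)
    also have "\<dots> \<le> d * (real n + 1)"
      using c sum0 by (intro mult_left_mono) (auto simp: d_def)
    finally show ?thesis .
  next
    case False
    then have "f n \<le> c * real n"
      using n0[of n] by simp
    also have "\<dots> \<le> d * (real n + 1)"
      using c sum0 by (intro mult_mono) (auto simp: d_def)
    finally show ?thesis .
  qed
  then show ?thesis
    using that[of d] c sum0 by (simp add: d_def)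
qed

lemma bigo_Suc_cube: "(\<lambda>n. c * (real n + 1) ^ 3) \<in> O(\<lambda>n. real n ^ 3)"
proof (rule bigoI)
  show "eventually (\<lambda>n. norm (c * (real n + 1) ^ 3) \<le> (\<bar>c\<bar> * 8) * norm (real n ^ 3)) at_top"
    using eventually_ge_at_top[of 1]
  proof eventually_elim
    case (elim n)
    then have "(real n + 1) ^ 3 \<le> (2 * real n) ^ 3"
      by (intro power_mono) auto
    also have "\<dots> = 8 * real n ^ 3"
      by (simp add: power_mult_distrib)
    finally have "\<bar>c\<bar> * (real n + 1) ^ 3 \<le> \<bar>c\<bar> * (8 * real n ^ 3)"
      by (intro mult_left_mono) auto
    then show ?case
      by (simp add: abs_mult power_abs)
  qed
qed

text \<open>The constant is obtained before the state, so that one constant serves all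
  inputs.\<close>

lemma elehot_correct:
  assumes lehot: "lehot_algorithm lehot"
  obtains c where "0 \<le> c"
    "\<And>s. holds_simple_graph (s ''Gc'') \<Longrightarrow> \<exists>t s'. exec (contract ;; lehot ;; multiply_edges) s t s' \<and>
       s' ''found'' 0 = (if is_line_multigraph (graph_of (s ''Gc'')) then 1 else 0) \<and>
       (s' ''found'' 0 = 1 \<longrightarrow> multigraph (multigraph_of (s' ''out'')) \<and>
          isomorphic (line_graph_of_multigraph (multigraph_of (s' ''out''))) (graph_of (s ''Gc''))) \<and>
       real t \<le> c * (real (s ''Gc'' 0) + 1) ^ 3"
proof -
  obtain T where "T \<in> O(\<lambda>n. real n)" and run: "\<And>s. holds_simple_graph (s ''H'') \<Longrightarrow>
       \<exists>t s'. exec lehot s t s' \<and>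
          real t \<le> T (card (verts (graph_of (s ''H''))) + card (edges (graph_of (s ''H'')))) \<and>
          s' ''label'' = s ''label'' \<and>
          s' ''found'' 0 = (if is_line_graph (graph_of (s ''H'')) then 1 else 0) \<and>
          (s' ''found'' 0 = 1 \<longrightarrow> holds_simple_graph (s' ''root'') \<and>
             graph_iso (edge_at (s' ''root'')) (graph_of (s ''H''))
               (line_graph (graph_of (s' ''root''))))"
    using lehot unfolding lehot_algorithm_def by blast
  obtain c where c: "0 \<le> c" "\<And>n. T n \<le> c * (real n + 1)"
    by (rule bigo_linear_bound[OF \<open>T \<in> O(\<lambda>n. real n)\<close>]) (rule that)
  let ?c = "real (coef contract) + c + real (coef multiply_edges)"
  show ?thesis
  proof (rule that[of ?c], goal_cases)
    case 1
    show ?case using c(1) by simp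
  next
    case (2 s)
    define a where "a = s ''Gc''"
    define n where "n = a 0"
    have a: "holds_simple_graph a"
      using 2 by (simp add: a_def)
    then have X: "simple_graph (graph_of a)"
      by (simp add: holds_simple_graph_def)
    obtain t1 s1 f where 1: "exec contract s t1 s1" "t1 \<le> coef contract * Suc n ^ 3"
      and H: "holds_simple_graph (s1 ''H'')"
      and f: "graph_iso f (graph_of (s1 ''H'')) (contraction (graph_of a))"
      and label: "\<And>k. k < s1 ''H'' 0 \<Longrightarrow> s1 ''label'' k = card (f k)"
      using runs_contract[where s = s and B = "Suc (s ''Gc'' 0)", OF 2 lessI] unfolding runs_def a_def[symmetric] n_def[symmetric] by blast
    define h where "h = s1 ''H'' 0"
    have vH: "verts (graph_of (s1 ''H'')) = {..<h}"
      by (simp add: graph_of_def h_def)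
    have vX: "verts (graph_of a) = {..<n}"
      by (simp add: graph_of_def n_def)
    have bf: "bij_betw f {..<h} (twin_class (graph_of a) ` {..<n})"
      using f unfolding graph_iso_def vH by (simp add: contraction_def vX)
    have hn: "h \<le> n"
      using bij_betw_same_card[OF bf] card_image_le[of "{..<n}" "twin_class (graph_of a)"] by simp
    have card_f: "card (f k) \<le> n" if "k < h" for k
    proof -
      have "f k \<subseteq> {..<n}"
        using bij_betw_apply[OF bf, of k] that by (auto simp: twin_class_def vX)
      then show ?thesis
        using card_mono[of "{..<n}" "f k"] by simp
    qed
    obtain t2 s2 where 2: "exec lehot s1 t2 s2"
        "real t2 \<le> T (card (verts (graph_of (s1 ''H''))) + card (edges (graph_of (s1 ''H''))))"
      and label2: "s2 ''label'' = s1 ''label''"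
      and found2: "s2 ''found'' 0 = (if is_line_graph (graph_of (s1 ''H'')) then 1 else 0)"
      and root2: "s2 ''found'' 0 = 1 \<Longrightarrow> holds_simple_graph (s2 ''root'')"
        "s2 ''found'' 0 = 1 \<Longrightarrow> graph_iso (edge_at (s2 ''root'')) (graph_of (s1 ''H''))
          (line_graph (graph_of (s2 ''root'')))"
      using run[of s1, OF H] by blast
    \<comment> \<open>The vertices of \<open>H\<close> correspond to the edges of the root, so the
      third step loops over \<open>h\<close> edges.\<close>
    have size: "s2 ''root'' 1 = h" if "s2 ''found'' 0 = 1"
    proof -
      have "bij_betw (edge_at (s2 ''root'')) {..<h} (edges (graph_of (s2 ''root'')))"
        using root2(2)[OF that] unfolding graph_iso_def vH verts_line_graph by blast
      from bij_betw_same_card[OF this] show ?thesis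
        using card_edges_graph_of[OF root2(1)[OF that]] by simp
    qed
    have "runs (Suc n) 2 multiply_edges s2 (\<lambda>s'. s' ''found'' 0 = s2 ''found'' 0 \<and>
      (s2 ''found'' 0 = 1 \<longrightarrow> s' ''out'' 0 = s2 ''root'' 0 \<and>
        (\<exists>\<beta>. bij_betw \<beta> {..<s' ''out'' 1} (SIGMA k:{..<s2 ''root'' 1}. {..<s2 ''label'' k}) \<and>
           (\<forall>j<s' ''out'' 1. edge_at (s' ''out'') j = edge_at (s2 ''root'') (fst (\<beta> j))))))"
      by (rule runs_multiply_edges)
        (use size hn card_f label label2 in \<open>auto simp: h_def less_Suc_eq_le\<close>)
    from runs_raise[OF this, of 3] obtain t3 s3 where 3: "exec multiply_edges s2 t3 s3"
        "t3 \<le> coef multiply_edges * Suc n ^ 3"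
      and found3: "s3 ''found'' 0 = s2 ''found'' 0"
      and out: "s2 ''found'' 0 = 1 \<Longrightarrow> s3 ''out'' 0 = s2 ''root'' 0"
        "s2 ''found'' 0 = 1 \<Longrightarrow> \<exists>\<beta>. bij_betw \<beta> {..<s3 ''out'' 1} (SIGMA k:{..<s2 ''root'' 1}. {..<s2 ''label'' k}) \<and>
           (\<forall>j<s3 ''out'' 1. edge_at (s3 ''out'') j = edge_at (s2 ''root'') (fst (\<beta> j)))"
      unfolding runs_def by auto
    let ?Z = "multigraph_of (s3 ''out'')"
    have Z: "multigraph ?Z \<and> isomorphic (line_graph_of_multigraph ?Z) (graph_of a)"
      if found: "s2 ''found'' 0 = 1"
    proof -
      obtain \<beta> where \<beta>: "bij_betw \<beta> {..<s3 ''out'' 1} (SIGMA k:{..<s2 ''root'' 1}. {..<s2 ''label'' k})"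
          "\<And>j. j < s3 ''out'' 1 \<Longrightarrow> edge_at (s3 ''out'') j = edge_at (s2 ''root'') (fst (\<beta> j))"
        using out(2)[OF found] by blast
      have "(SIGMA k:{..<s2 ''root'' 1}. {..<s2 ''label'' k}) = (SIGMA k:{..<h}. {..<card (f k)})"
        using size[OF found] label by (auto simp: label2 h_def)
      with \<beta>(1) have \<beta>': "bij_betw \<beta> {..<s3 ''out'' 1} (SIGMA k:{..<h}. {..<card (f k)})"
        by simp
      show ?thesis
      proof (rule line_graph_multiplied_root[OF X f _ root2(2)[OF found]])
        show "simple_graph (graph_of (s2 ''root''))"
          using root2(1)[OF found] by (simp add: holds_simple_graph_def)
        show "bij_betw \<beta> (medges ?Z) (SIGMA k:verts (graph_of (s1 ''H'')). {..<card (f k)})"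
          using \<beta>' unfolding vH by (simp add: multigraph_of_def)
      qed (use out(1)[OF found] \<beta>(2) in \<open>simp_all add: multigraph_of_def graph_of_def\<close>)
    qed
    \<comment> \<open>If \<open>H\<close> is a line graph, the multigraph just built is itself the
      witness, since arrays name vertices and edges by numbers; otherwise
      \<open>line_multigraph_contraction\<close> excludes any root.\<close>
    have found: "s3 ''found'' 0 = (if is_line_multigraph (graph_of a) then 1 else 0)"
    proof (cases "is_line_graph (graph_of (s1 ''H''))")
      case True
      then have "is_line_multigraph (graph_of a)"
        using Z found2 unfolding is_line_multigraph_def by auto
      with True found2 found3 show ?thesis by simp
    next
      case False
      then have "\<not> is_line_multigraph (graph_of a)"
        using line_multigraph_contraction[OF _ f] by blast
      with False found2 found3 show ?thesis by simp
    qed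
    have "card (edges (graph_of (s1 ''H''))) \<le> h * h"
      using simple_graph_card_edges_le[of "graph_of (s1 ''H'')"] H
      unfolding holds_simple_graph_def vH by simp
    also have "\<dots> \<le> n * n"
      using hn by (rule mult_le_mono) (rule hn)
    \<comment> \<open>Vertices, edges and the 1 from \<open>bigo_linear_bound\<close> amount to at
      most \<open>n + n * n + 1\<close>. Lehot's share is thus quadratic and is rounded up to the
      cube.\<close>
    finally have "card (verts (graph_of (s1 ''H''))) + card (edges (graph_of (s1 ''H''))) + 1 \<le> Suc n ^ 3"
      using hn by (simp add: vH power3_eq_cube algebra_simps)
    then have "real (card (verts (graph_of (s1 ''H''))) + card (edges (graph_of (s1 ''H'')))) + 1 \<le> real (Suc n ^ 3)"
      by linarith
    then have "real t2 \<le> c * real (Suc n ^ 3)"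
      using 2(2) c by (meson le_trans mult_left_mono order_trans)
    moreover have "real t1 \<le> real (coef contract) * real (Suc n ^ 3)"
      using 1(2) by (metis of_nat_le_iff of_nat_mult)
    moreover have "real t3 \<le> real (coef multiply_edges) * real (Suc n ^ 3)"
      using 3(2) by (metis of_nat_le_iff of_nat_mult)
    ultimately have "real (t1 + (t2 + t3)) \<le> ?c * real (Suc n ^ 3)"
      by (simp add: distrib_right)
    also have "real (Suc n ^ 3) = (real n + 1) ^ 3"
      by (simp add: add.commute)
    finally have time: "real (t1 + (t2 + t3)) \<le> ?c * (real n + 1) ^ 3" .
    have "exec (contract ;; lehot ;; multiply_edges) s (t1 + (t2 + t3)) s3"
      by (rule exec.Seq[OF 1(1) exec.Seq[OF 2(1) 3(1)]])
    with found Z found3 time show ?case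
      unfolding a_def[symmetric] n_def[symmetric] by (metis)
  qed
qed

theorem theorem3:
  fixes lehot :: com
  assumes "lehot_algorithm lehot"
  shows "\<exists>construct elehot (T :: nat \<Rightarrow> real).
    elehot_algorithm lehot elehot \<and> T \<in> O(\<lambda>n. real n ^ 3) \<and>
    (\<forall>(G :: 'v graph) M s.
       simple_graph G \<and> 1 \<le> M \<and> stores (s ''G'') G \<and> s ''M'' 0 = M \<longrightarrow>
       (\<exists>t1 s1 t2 s2.
          exec construct s t1 s1 \<and> stores (s1 ''Gc'') (conflict_graph G M) \<and>
          exec elehot s1 t2 s2 \<and>
          s2 ''found'' 0 = (if is_line_multigraph (conflict_graph G M) then 1 else 0) \<and>
          (s2 ''found'' 0 = 1 \<longrightarrow>
             multigraph (multigraph_of (s2 ''out'')) \<and>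
             isomorphic (line_graph_of_multigraph (multigraph_of (s2 ''out'')))
               (conflict_graph G M)) \<and>
          real (t1 + t2) \<le> T (card (edges G))))"
proof -
  obtain c where c: "0 \<le> c"
    and elehot: "\<And>s. holds_simple_graph (s ''Gc'') \<Longrightarrow> \<exists>t s'. exec (contract ;; lehot ;; multiply_edges) s t s' \<and>
       s' ''found'' 0 = (if is_line_multigraph (graph_of (s ''Gc'')) then 1 else 0) \<and>
       (s' ''found'' 0 = 1 \<longrightarrow> multigraph (multigraph_of (s' ''out'')) \<and>
          isomorphic (line_graph_of_multigraph (multigraph_of (s' ''out''))) (graph_of (s ''Gc''))) \<and>
       real t \<le> c * (real (s ''Gc'' 0) + 1) ^ 3"
    using elehot_correct[OF assms] by blast
  define T where "T n = (real (coef construct_conflict_graph) + c) * (real n + 1) ^ 3" for n :: nat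
  show ?thesis
  proof (rule exI[of _ construct_conflict_graph], rule exI[of _ "contract ;; lehot ;; multiply_edges"], rule exI[of _ T],
      intro conjI allI impI)
    show "elehot_algorithm lehot (contract ;; lehot ;; multiply_edges)"
      unfolding elehot_algorithm_def
      using contracts_true_twins_contract multiplies_edges_multiply_edges by blast
    show "T \<in> O(\<lambda>n. real n ^ 3)"
      unfolding T_def by (rule bigo_Suc_cube)
    fix G :: "'v graph" and M s
    assume asm: "simple_graph G \<and> 1 \<le> M \<and> stores (s ''G'') G \<and> s ''M'' 0 = M"
    then have G: "simple_graph G" and a: "holds_simple_graph (s ''G'')"
      and iso: "isomorphic (graph_of (s ''G'')) G" and M: "s ''M'' 0 = M"
      by (simp_all add: stores_def)
    have X: "simple_graph (graph_of (s ''G''))"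
      using a by (simp add: holds_simple_graph_def)
    \<comment> \<open>Turns bounds in the length of the stored edge list into bounds in the size of
      \<open>G\<close>.\<close>
    have n: "s ''G'' 1 = card (edges G)"
      using iso graph_iso_card_edges[OF X G] card_edges_graph_of[OF a] by (auto simp: isomorphic_def)
    obtain t1 s1 where 1: "exec construct_conflict_graph s t1 s1" "t1 \<le> coef construct_conflict_graph * Suc (card (edges G)) ^ 3"
      and Gc: "holds_simple_graph (s1 ''Gc'')" "s1 ''Gc'' 0 = card (edges G)"
        "isomorphic (graph_of (s1 ''Gc'')) (conflict_graph (graph_of (s ''G'')) M)"
      using runs_construct_conflict_graph[where s = s and B = "Suc (s ''G'' 1)", OF a] unfolding runs_def n M by auto
    \<comment> \<open>eLehot sees only the stored copy; its answers are transported to the conflict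
      graph along this isomorphism.\<close>
    have iso': "isomorphic (graph_of (s1 ''Gc'')) (conflict_graph G M)"
      using Gc(3) isomorphic_conflict_graph[OF X G iso] by (rule isomorphic_trans)
    obtain t2 s2 where 2: "exec (contract ;; lehot ;; multiply_edges) s1 t2 s2"
      and found: "s2 ''found'' 0 = (if is_line_multigraph (graph_of (s1 ''Gc'')) then 1 else 0)"
      and out: "s2 ''found'' 0 = 1 \<Longrightarrow> multigraph (multigraph_of (s2 ''out''))"
        "s2 ''found'' 0 = 1 \<Longrightarrow>
          isomorphic (line_graph_of_multigraph (multigraph_of (s2 ''out''))) (graph_of (s1 ''Gc''))"
      and t2: "real t2 \<le> c * (real (card (edges G)) + 1) ^ 3"
      using elehot[of s1, OF Gc(1)] unfolding Gc(2) by blast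
    have "real t1 \<le> real (coef construct_conflict_graph * Suc (card (edges G)) ^ 3)"
      using 1(2) by (simp only: of_nat_le_iff)
    also have "\<dots> = real (coef construct_conflict_graph) * (real (card (edges G)) + 1) ^ 3"
      by (simp add: add.commute)
    finally have time: "real (t1 + t2) \<le> T (card (edges G))"
      using t2 by (simp add: T_def distrib_right)
    have "stores (s1 ''Gc'') (conflict_graph G M)"
      using Gc(1) iso' by (simp add: stores_def)
    moreover have "s2 ''found'' 0 = (if is_line_multigraph (conflict_graph G M) then 1 else 0)"
      using found is_line_multigraph_iso[OF iso'] by simp
    moreover have "isomorphic (line_graph_of_multigraph (multigraph_of (s2 ''out''))) (conflict_graph G M)"
      if "s2 ''found'' 0 = 1"
      using out(2)[OF that] iso' by (rule isomorphic_trans)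
    ultimately show "\<exists>t1 s1 t2 s2.
        exec construct_conflict_graph s t1 s1 \<and> stores (s1 ''Gc'') (conflict_graph G M) \<and>
        exec (contract ;; lehot ;; multiply_edges) s1 t2 s2 \<and>
        s2 ''found'' 0 = (if is_line_multigraph (conflict_graph G M) then 1 else 0) \<and>
        (s2 ''found'' 0 = 1 \<longrightarrow>
           multigraph (multigraph_of (s2 ''out'')) \<and>
           isomorphic (line_graph_of_multigraph (multigraph_of (s2 ''out''))) (conflict_graph G M)) \<and>
        real (t1 + t2) \<le> T (card (edges G))"
      using 1(1) 2 out(1) time by blast
  qed
qed

end
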